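(* Let $C \subseteq \mathbb{N}$ be a set and let $A \subseteq \mathbb{N}$ be a set with $A \not\leq_T C$. For every $C$-computably bounded function $f : \mathbb{N} \to \mathbb{N}$, there is an infinite set $G \subseteq \mathbb{N}$ which is non-decreasing for $f$ and such that $A \not\leq_T G \oplus C$.
   Context: A set $X \subseteq \mathbb{N}$ is non-decreasing for $f : \mathbb{N} \to \mathbb{N}$ if $f(x) \leq f(y)$ for every pair $x < y$ in $X$. A function $f : \mathbb{N}\to\mathbb{N}$ is $C$-computably bounded if there is a $C$-computable function $b : \mathbb{N} \to \mathbb{N}$ with $f(x) \leq b(x)$ for all $x$ (the function $f$ itself is not assumed to be $C$-computable, nor of any particular complexity). $\leq_T$ is Turing reducibility and $\oplus$ is the join. *)

theory Defs
  imports Main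
begin

text \<open>
  Computability relative to an oracle is Kleene's: the partial functions obtained from the initial
  functions and the characteristic function of the oracle by composition, primitive recursion and
  unbounded search.  Functions are given by codes, and a code is applied to a list of arguments.
\<close>

datatype recf =
    Zero
  | Succ
  | Proj nat
  | Oracle
  | Comp recf "recf list"
  | Prim recf recf
  | Mu recf

text \<open>
  \<open>eval X e xs y\<close>: code \<open>e\<close> with oracle \<open>X\<close> converges to \<open>y\<close> on the arguments \<open>xs\<close>.  It diverges
  if there is no such \<open>y\<close>.  Arities are not tracked: \<open>Zero\<close> is the constant zero of every arity,
  \<open>Proj i\<close> the projection to the argument number \<open>i\<close> (counting from 0) of every arity exceeding \<open>i\<close>,
  and a code diverges on a list that is too short or too long for it.  The argument of the recursion and the argument searched for are the first ones in the list.
  In the last rule, all values before the first zero are required to converge.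
\<close>

inductive eval :: "nat set \<Rightarrow> recf \<Rightarrow> nat list \<Rightarrow> nat \<Rightarrow> bool" for X :: "nat set" where
  eval_Zero: "eval X Zero xs 0"
| eval_Succ: "eval X Succ [x] (Suc x)"
| eval_Proj: "i < length xs \<Longrightarrow> eval X (Proj i) xs (xs ! i)"
| eval_Oracle: "eval X Oracle [x] (of_bool (x \<in> X))"
| eval_Comp: "list_all2 (\<lambda>g y. eval X g xs y) gs ys \<Longrightarrow> eval X f ys z \<Longrightarrow> eval X (Comp f gs) xs z"
| eval_Prim_0: "eval X f xs y \<Longrightarrow> eval X (Prim f g) (0 # xs) y"
| eval_Prim_Suc: "eval X (Prim f g) (n # xs) r \<Longrightarrow> eval X g (n # r # xs) y
    \<Longrightarrow> eval X (Prim f g) (Suc n # xs) y"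
| eval_Mu: "eval X f (n # xs) 0 \<Longrightarrow> (\<forall>m<n. \<exists>k. eval X f (m # xs) (Suc k))
    \<Longrightarrow> eval X (Mu f) xs n"

lemma eval_deterministic: "eval X e xs y \<Longrightarrow> eval X e xs z \<Longrightarrow> y = z"
proof (induction arbitrary: z rule: eval.induct)
  case (eval_Zero xs)
  then show ?case by cases simp_all
next
  case (eval_Succ x)
  then show ?case by cases simp_all
next
  case (eval_Proj i xs)
  from eval_Proj.prems show ?case by cases simp
next
  case (eval_Oracle x)
  then show ?case by cases simp_all
next
  case (eval_Comp xs gs ys f y)
  from eval_Comp.prems obtain ys'
    where ys': "list_all2 (\<lambda>g y. eval X g xs y) gs ys'" "eval X f ys' z"
    by cases blast
  have "ys = ys'"
  proof (rule nth_equalityI)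
    show "length ys = length ys'"
      using list_all2_lengthD[OF eval_Comp.IH(1)] list_all2_lengthD[OF ys'(1)] by simp
    show "ys ! i = ys' ! i" if "i < length ys" for i
      using list_all2_nthD2[OF eval_Comp.IH(1) that] list_all2_nthD[OF ys'(1), of i] that
        list_all2_lengthD[OF eval_Comp.IH(1)] by simp
  qed
  then show ?case using eval_Comp.IH(2) ys'(2) by blast
next
  case (eval_Prim_0 f xs y g)
  from eval_Prim_0.prems eval_Prim_0.IH show ?case by cases blast
next
  case (eval_Prim_Suc f g n xs r y)
  from eval_Prim_Suc.prems obtain r' where "eval X (Prim f g) (n # xs) r'" "eval X g (n # r' # xs) z"
    by cases blast
  then show ?case using eval_Prim_Suc.IH by blast
next
  case (eval_Mu f n xs)
  from eval_Mu.prems have z: "eval X f (z # xs) 0" "\<forall>m<z. \<exists>k. eval X f (m # xs) (Suc k)"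
    by (cases, blast)+
  have "\<not> n < z"
  proof
    assume "n < z"
    then obtain k where "eval X f (n # xs) (Suc k)" using z(2) by blast
    then have "0 = Suc k" using eval_Mu.IH(1) by blast
    then show False by simp
  qed
  moreover have "\<not> z < n"
  proof
    assume "z < n"
    then obtain k where "\<forall>v. eval X f (z # xs) v \<longrightarrow> Suc k = v" using eval_Mu.IH(2) by blast
    then have "Suc k = 0" using z(1) by blast
    then show False by simp
  qed
  ultimately show ?case by simp
qed

definition computable_in :: "nat set \<Rightarrow> (nat \<Rightarrow> nat) \<Rightarrow> bool" where
  "computable_in X f \<longleftrightarrow> (\<exists>e. \<forall>x. eval X e [x] (f x))"

definition turing_reducible :: "nat set \<Rightarrow> nat set \<Rightarrow> bool"  (infix "\<le>\<^sub>T" 50) where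
  "A \<le>\<^sub>T X \<longleftrightarrow> computable_in X (\<lambda>x. of_bool (x \<in> A))"

definition turing_join :: "nat set \<Rightarrow> nat set \<Rightarrow> nat set"  (infixl "\<oplus>" 65) where
  "A \<oplus> B = {2 * n | n. n \<in> A} \<union> {2 * n + 1 | n. n \<in> B}"

definition computably_bounded_in :: "nat set \<Rightarrow> (nat \<Rightarrow> nat) \<Rightarrow> bool" where
  "computably_bounded_in X f \<longleftrightarrow> (\<exists>b. computable_in X b \<and> (\<forall>x. f x \<le> b x))"

end

theory Submission
  imports Defs "HOL-Library.Countable" "HOL-Library.Nat_Bijection"
begin

text \<open>
  The set is built by Mathias forcing with conditions \<open>(F, X)\<close>, where \<open>F\<close> is finite and non-decreasing
  and the infinite reservoir \<open>X\<close> satisfies \<open>A \<not>\<le>\<^sub>T X \<oplus> C\<close> and lies above \<open>F\<close> both in position and in the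
  values of \<open>f\<close>.  To defeat a functional, consider all functions \<open>g\<close> below the computable bound, a
  compact space.  By compactness it is semidecidable whether every \<open>g\<close> admits a finite
  \<open>g\<close>-non-decreasing extension of \<open>F\<close> inside \<open>X\<close> that makes the functional output \<open>v\<close> at \<open>n\<close>.  If this
  happens for some wrong \<open>v\<close>, take \<open>g = f\<close>.  If it fails for the correct value at some \<open>n\<close>, the cone
  avoidance basis theorem yields a counterexample \<open>g\<close> not helping to compute \<open>A\<close>, and the reservoir
  is thinned to a \<open>g\<close>-non-decreasing subset.  Otherwise \<open>A\<close> would be computable from \<open>X \<oplus> C\<close>.
  Reservoirs on which \<open>f\<close> is large exist by strong cone avoidance for two colours: if one cannot
  raise the lower bound of \<open>f\<close>, then \<open>f\<close> is constant on a cone-avoiding infinite set.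
\<close>

section \<open>Uniform relative computability\<close>

text \<open>One code serves every index \<open>i\<close>. Later the index is a set ranging over
  Cantor space, and this uniformity is what the compactness argument works with. Arguments form a
  list of fixed length \<open>k\<close> so that a binder can push a value onto the front:
  \<open>hd\<close> is then the bound variable and \<open>tl\<close> the context.\<close>

definition computable_on :: "('i \<Rightarrow> nat set) \<Rightarrow> nat \<Rightarrow> ('i \<Rightarrow> nat list \<Rightarrow> nat) \<Rightarrow> bool" where
  "computable_on \<Phi> k h \<longleftrightarrow> (\<exists>e. \<forall>i xs. length xs = k \<longrightarrow> eval (\<Phi> i) e xs (h i xs))"

definition decidable_on :: "('i \<Rightarrow> nat set) \<Rightarrow> nat \<Rightarrow> ('i \<Rightarrow> nat list \<Rightarrow> bool) \<Rightarrow> bool" where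
  "decidable_on \<Phi> k P \<longleftrightarrow> computable_on \<Phi> k (\<lambda>i xs. of_bool (P i xs))"

lemma computable_on_cong:
  assumes "computable_on \<Phi> k h" "\<And>i xs. length xs = k \<Longrightarrow> h i xs = h' i xs"
  shows "computable_on \<Phi> k h'"
  using assms unfolding computable_on_def by simp

lemma decidable_on_cong:
  assumes "decidable_on \<Phi> k P" "\<And>i xs. length xs = k \<Longrightarrow> P i xs \<longleftrightarrow> P' i xs"
  shows "decidable_on \<Phi> k P'"
  using assms unfolding decidable_on_def by (auto elim: computable_on_cong)

lemma computable_on_comp:
  assumes h: "computable_on \<Phi> (length gs) h" and gs: "\<And>g. g \<in> set gs \<Longrightarrow> computable_on \<Phi> k g"
  shows "computable_on \<Phi> k (\<lambda>i xs. h i (map (\<lambda>g. g i xs) gs))"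
proof -
  obtain e where e: "\<forall>i xs. length xs = length gs \<longrightarrow> eval (\<Phi> i) e xs (h i xs)"
    using h unfolding computable_on_def ..
  have "\<forall>g\<in>set gs. \<exists>e. \<forall>i xs. length xs = k \<longrightarrow> eval (\<Phi> i) e xs (g i xs)"
    using gs[unfolded computable_on_def] by (rule ballI)
  from bchoice[OF this]
  obtain c where c: "\<forall>g\<in>set gs. \<forall>i xs. length xs = k \<longrightarrow> eval (\<Phi> i) (c g) xs (g i xs)" ..
  have "eval (\<Phi> i) (Comp e (map c gs)) xs (h i (map (\<lambda>g. g i xs) gs))" if "length xs = k" for i xs
  proof (rule eval_Comp)
    show "list_all2 (\<lambda>g y. eval (\<Phi> i) g xs y) (map c gs) (map (\<lambda>g. g i xs) gs)"
      using c that by (auto simp: list_all2_conv_all_nth)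
  qed (use e in simp)
  then show ?thesis unfolding computable_on_def by (intro exI allI impI)
qed

lemma computable_on_const: "computable_on \<Phi> k (\<lambda>i xs. c)"
proof (induction c)
  case 0
  then show ?case unfolding computable_on_def by (meson eval_Zero)
next
  case (Suc c)
  have "computable_on \<Phi> (length [\<lambda>i xs. c]) (\<lambda>i xs. Suc (hd xs))"
    unfolding computable_on_def
    by (rule exI[of _ Succ]) (auto simp: length_Suc_conv intro: eval_Succ)
  from computable_on_comp[OF this, of k] Suc show ?case by simp
qed

lemma computable_on_nth: "j < k \<Longrightarrow> computable_on \<Phi> k (\<lambda>i xs. xs ! j)"
  unfolding computable_on_def by (metis eval_Proj)

lemma computable_on_hd: "computable_on \<Phi> (Suc k) (\<lambda>i xs. hd xs)"
  by (rule computable_on_cong[OF computable_on_nth[of 0]]) (auto simp: hd_conv_nth length_Suc_conv)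

text \<open>Weakening under a binder: the old context is recovered by composing with the projections
  that skip the first argument.\<close>

lemma computable_on_tl:
  assumes "computable_on \<Phi> k h"
  shows "computable_on \<Phi> (Suc k) (\<lambda>i xs. h i (tl xs))"
proof -
  define gs where "gs = map (\<lambda>j (i::'a) (xs::nat list). xs ! Suc j) [0..<k]"
  have 1: "computable_on \<Phi> (length gs) h" using assms by (simp add: gs_def)
  have "computable_on \<Phi> (Suc k) (\<lambda>i xs. h i (map (\<lambda>g. g i xs) gs))"
    by (rule computable_on_comp[OF 1]) (auto simp: gs_def intro: computable_on_nth)
  then show ?thesis
  proof (rule computable_on_cong)
    fix i and xs :: "nat list" assume "length xs = Suc k"
    then have "map (\<lambda>g. g i xs) gs = tl xs"
      by (auto simp: gs_def nth_tl intro!: nth_equalityI)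
    then show "h i (map (\<lambda>g. g i xs) gs) = h i (tl xs)" by simp
  qed
qed

lemma computable_on_comp1:
  assumes "computable_on \<Phi> 1 (\<lambda>i xs. h i (hd xs))" "computable_on \<Phi> k a"
  shows "computable_on \<Phi> k (\<lambda>i xs. h i (a i xs))"
  using computable_on_comp[of \<Phi> "[a]" "\<lambda>i xs. h i (hd xs)" k] assms by simp

lemma computable_on_Suc: "computable_on \<Phi> k a \<Longrightarrow> computable_on \<Phi> k (\<lambda>i xs. Suc (a i xs))"
  by (rule computable_on_comp1)
    (auto simp: computable_on_def length_Suc_conv intro!: exI[of _ Succ] eval_Succ)

text \<open>\<open>rec_nat\<close> agrees with \<open>Prim\<close>, whose step code receives the
  counter, the previous value and then the parameters, in this order.\<close>

lemma computable_on_rec_nat: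
  assumes n: "computable_on \<Phi> k n" and a: "computable_on \<Phi> k a"
    and g: "computable_on \<Phi> (Suc (Suc k)) (\<lambda>i ys. g i (hd ys) (hd (tl ys)) (tl (tl ys)))"
  shows "computable_on \<Phi> k (\<lambda>i xs. rec_nat (a i xs) (\<lambda>m r. g i m r xs) (n i xs))"
proof -
  obtain ea where ea: "\<forall>i xs. length xs = k \<longrightarrow> eval (\<Phi> i) ea xs (a i xs)"
    using a unfolding computable_on_def ..
  obtain eg where eg: "\<And>i m r xs. length xs = k \<Longrightarrow> eval (\<Phi> i) eg (m # r # xs) (g i m r xs)"
  proof -
    obtain e where e: "\<forall>i ys. length ys = Suc (Suc k) \<longrightarrow> eval (\<Phi> i) e ys (g i (hd ys) (hd (tl ys)) (tl (tl ys)))"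
      using g unfolding computable_on_def ..
    have "eval (\<Phi> i) e (m # r # xs) (g i m r xs)" if "length xs = k" for i m r xs
      using that by (simp add: e[rule_format, of "m # r # xs" i, simplified])
    then show ?thesis by (rule that)
  qed
  have rec: "eval (\<Phi> i) (Prim ea eg) (m # xs) (rec_nat (a i xs) (\<lambda>m r. g i m r xs) m)"
    if "length xs = k" for i m xs
    by (induction m) (simp_all add: eval_Prim_0 eval_Prim_Suc[OF _ eg] ea that)
  have 1: "computable_on \<Phi> (Suc k) (\<lambda>i ys. rec_nat (a i (tl ys)) (\<lambda>m r. g i m r (tl ys)) (hd ys))"
    unfolding computable_on_def
  proof (intro exI allI impI)
    fix i and ys :: "nat list" assume "length ys = Suc k"
    then show "eval (\<Phi> i) (Prim ea eg) ys (rec_nat (a i (tl ys)) (\<lambda>m r. g i m r (tl ys)) (hd ys))"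
      using rec[of "tl ys" i "hd ys"] by (cases ys) auto
  qed
  define gs where "gs = n # map (\<lambda>j (i::'a) (xs::nat list). xs ! j) [0..<k]"
  have 2: "computable_on \<Phi> (length gs) (\<lambda>i ys. rec_nat (a i (tl ys)) (\<lambda>m r. g i m r (tl ys)) (hd ys))"
    using 1 by (simp add: gs_def)
  show ?thesis
  proof (rule computable_on_cong[OF computable_on_comp[OF 2]])
    show "computable_on \<Phi> k h" if "h \<in> set gs" for h
      using that n by (auto simp: gs_def intro: computable_on_nth)
    fix i and xs :: "nat list" assume l: "length xs = k"
    then have "map (\<lambda>g. g i xs) gs = n i xs # xs"
      by (auto simp: gs_def intro!: nth_equalityI)
    then show "rec_nat (a i (tl (map (\<lambda>g. g i xs) gs))) (\<lambda>m r. g i m r (tl (map (\<lambda>g. g i xs) gs))) (hd (map (\<lambda>g. g i xs) gs))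
      = rec_nat (a i xs) (\<lambda>m r. g i m r xs) (n i xs)" by simp
  qed
qed

text \<open>\<open>Mu\<close> finds the least zero because \<open>h\<close> is total, so every value
  before the zero converges, and \<open>ex\<close> supplies a zero.\<close>

lemma computable_on_Least_zero:
  assumes h: "computable_on \<Phi> (Suc k) (\<lambda>i ys. h i (hd ys) (tl ys))"
    and ex: "\<And>i xs. length xs = k \<Longrightarrow> \<exists>m. h i m xs = 0"
  shows "computable_on \<Phi> k (\<lambda>i xs. LEAST m. h i m xs = 0)"
proof -
  obtain e where *: "\<forall>i ys. length ys = Suc k \<longrightarrow> eval (\<Phi> i) e ys (h i (hd ys) (tl ys))"
    using h unfolding computable_on_def ..
  have e: "eval (\<Phi> i) e (m # xs) (h i m xs)" if "length xs = k" for i m xs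
    using that by (simp add: *[rule_format, of "m # xs" i, simplified])
  have "eval (\<Phi> i) (Mu e) xs (LEAST m. h i m xs = 0)" if l: "length xs = k" for i xs
  proof (rule eval_Mu)
    have "h i (LEAST m. h i m xs = 0) xs = 0" using ex[OF l] by (rule LeastI_ex)
    then show "eval (\<Phi> i) e ((LEAST m. h i m xs = 0) # xs) 0"
      using e[OF l, of i "LEAST m. h i m xs = 0"] by simp
    show "\<forall>m<LEAST m. h i m xs = 0. \<exists>j. eval (\<Phi> i) e (m # xs) (Suc j)"
    proof (intro allI impI)
      fix m assume "m < (LEAST m. h i m xs = 0)"
      then obtain j where "h i m xs = Suc j" using not_less_Least not0_implies_Suc by blast
      then show "\<exists>j. eval (\<Phi> i) e (m # xs) (Suc j)" using e[OF l, of i m] by auto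
    qed
  qed
  then show ?thesis unfolding computable_on_def by (intro exI allI impI)
qed

section \<open>Arithmetic functions\<close>

lemma computable_on_add:
  assumes "computable_on \<Phi> k a" "computable_on \<Phi> k b"
  shows "computable_on \<Phi> k (\<lambda>i xs. a i xs + b i xs)"
proof -
  have *: "rec_nat x (\<lambda>m. Suc) y = x + y" for x y by (induction y) auto
  have "computable_on \<Phi> k (\<lambda>i xs. rec_nat (a i xs) (\<lambda>m. Suc) (b i xs))"
    by (intro computable_on_rec_nat assms computable_on_Suc computable_on_tl computable_on_hd)
  then show ?thesis by (simp add: *)
qed

lemma computable_on_mult:
  assumes "computable_on \<Phi> k a" "computable_on \<Phi> k b"
  shows "computable_on \<Phi> k (\<lambda>i xs. a i xs * b i xs)"
proof -
  have *: "rec_nat 0 (\<lambda>m r. r + x) y = x * y" for x y :: nat by (induction y) auto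
  have "computable_on \<Phi> k (\<lambda>i xs. rec_nat 0 (\<lambda>m r. r + a i xs) (b i xs))"
    by (intro computable_on_rec_nat assms computable_on_add computable_on_tl computable_on_hd computable_on_const)
  then show ?thesis by (simp add: *)
qed

lemma computable_on_pred:
  assumes "computable_on \<Phi> k a"
  shows "computable_on \<Phi> k (\<lambda>i xs. a i xs - 1)"
proof -
  have *: "rec_nat 0 (\<lambda>m r. m) y = y - 1" for y :: nat by (cases y) auto
  have "computable_on \<Phi> k (\<lambda>i xs. rec_nat 0 (\<lambda>m r. m) (a i xs))"
    by (intro computable_on_rec_nat assms computable_on_hd computable_on_const)
  then show ?thesis unfolding * .
qed

lemma computable_on_diff:
  assumes "computable_on \<Phi> k a" "computable_on \<Phi> k b"
  shows "computable_on \<Phi> k (\<lambda>i xs. a i xs - b i xs)"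
proof -
  have *: "rec_nat x (\<lambda>m r. r - 1) y = x - y" for x y :: nat by (induction y) auto
  have "computable_on \<Phi> k (\<lambda>i xs. rec_nat (a i xs) (\<lambda>m r. r - 1) (b i xs))"
    by (intro computable_on_rec_nat assms computable_on_pred computable_on_tl computable_on_hd)
  then show ?thesis unfolding * .
qed

lemma computable_on_div2:
  assumes "computable_on \<Phi> k a"
  shows "computable_on \<Phi> k (\<lambda>i xs. a i xs div 2)"
proof -
  \<comment> \<open>Since \<open>Suc y div 2 = y - y div 2\<close>, halving is a primitive recursion
    without a case distinction on parity.\<close>
  have *: "rec_nat 0 (\<lambda>m r. m - r) y = y div 2" for y :: nat
  proof (induction y)
    case (Suc y)
    have "y - y div 2 = Suc y div 2" by presburger
    with Suc show ?case by simp
  qed simp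
  have "computable_on \<Phi> k (\<lambda>i xs. rec_nat 0 (\<lambda>m r. m - r) (a i xs))"
    by (intro computable_on_rec_nat assms computable_on_diff computable_on_tl computable_on_hd computable_on_const)
  then show ?thesis unfolding * .
qed

lemma computable_on_pow2:
  assumes "computable_on \<Phi> k a"
  shows "computable_on \<Phi> k (\<lambda>i xs. 2 ^ a i xs)"
proof -
  have *: "rec_nat 1 (\<lambda>m r. r + r) y = (2::nat) ^ y" for y by (induction y) auto
  have "computable_on \<Phi> k (\<lambda>i xs. rec_nat 1 (\<lambda>m r. r + r) (a i xs))"
    by (intro computable_on_rec_nat assms computable_on_add computable_on_tl computable_on_hd computable_on_const)
  then show ?thesis unfolding * .
qed

section \<open>Decidable predicates, cases and bounded quantifiers\<close>

lemma decidable_on_not: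
  assumes "decidable_on \<Phi> k P"
  shows "decidable_on \<Phi> k (\<lambda>i xs. \<not> P i xs)"
proof -
  have *: "1 - of_bool Q = (of_bool (\<not> Q) :: nat)" for Q by simp
  have "computable_on \<Phi> k (\<lambda>i xs. 1 - of_bool (P i xs))"
    using assms unfolding decidable_on_def by (intro computable_on_diff computable_on_const)
  then show ?thesis unfolding * decidable_on_def .
qed

lemma decidable_on_conj:
  assumes "decidable_on \<Phi> k P" "decidable_on \<Phi> k Q"
  shows "decidable_on \<Phi> k (\<lambda>i xs. P i xs \<and> Q i xs)"
  unfolding decidable_on_def of_bool_conj
  using assms unfolding decidable_on_def by (rule computable_on_mult)

lemma decidable_on_disj:
  assumes "decidable_on \<Phi> k P" "decidable_on \<Phi> k Q"
  shows "decidable_on \<Phi> k (\<lambda>i xs. P i xs \<or> Q i xs)"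
  using decidable_on_not[OF decidable_on_conj[OF assms[THEN decidable_on_not]]] by simp

lemma decidable_on_imp:
  assumes "decidable_on \<Phi> k P" "decidable_on \<Phi> k Q"
  shows "decidable_on \<Phi> k (\<lambda>i xs. P i xs \<longrightarrow> Q i xs)"
  unfolding imp_conv_disj by (intro decidable_on_disj decidable_on_not assms)

lemma decidable_on_le:
  assumes "computable_on \<Phi> k a" "computable_on \<Phi> k b"
  shows "decidable_on \<Phi> k (\<lambda>i xs. a i xs \<le> b i xs)"
proof -
  have *: "1 - (x - y) = of_bool (x \<le> y)" for x y :: nat by simp
  have "computable_on \<Phi> k (\<lambda>i xs. 1 - (a i xs - b i xs))"
    by (intro assms computable_on_diff computable_on_const)
  then show ?thesis unfolding * decidable_on_def .
qed

lemma decidable_on_less: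
  assumes "computable_on \<Phi> k a" "computable_on \<Phi> k b"
  shows "decidable_on \<Phi> k (\<lambda>i xs. a i xs < b i xs)"
  unfolding not_le[symmetric] by (intro decidable_on_le decidable_on_not assms)

lemma decidable_on_eq:
  assumes "computable_on \<Phi> k a" "computable_on \<Phi> k b"
  shows "decidable_on \<Phi> k (\<lambda>i xs. a i xs = b i xs)"
  unfolding eq_iff[where 'a=nat] by (intro decidable_on_conj decidable_on_le assms)

lemma decidable_on_odd:
  assumes "computable_on \<Phi> k a"
  shows "decidable_on \<Phi> k (\<lambda>i xs. odd (a i xs))"
proof -
  have *: "odd y \<longleftrightarrow> y \<noteq> y div 2 + y div 2" for y :: nat by presburger
  show ?thesis unfolding *
    by (intro decidable_on_not decidable_on_eq assms computable_on_add computable_on_div2)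
qed

lemma decidable_on_even:
  assumes "computable_on \<Phi> k a"
  shows "decidable_on \<Phi> k (\<lambda>i xs. even (a i xs))"
  using decidable_on_not[OF decidable_on_odd[OF assms]] by simp

lemma computable_on_of_bool:
  "decidable_on \<Phi> k P \<Longrightarrow> computable_on \<Phi> k (\<lambda>i xs. of_bool (P i xs))"
  unfolding decidable_on_def .

lemma computable_on_if:
  assumes "decidable_on \<Phi> k P" "computable_on \<Phi> k a" "computable_on \<Phi> k b"
  shows "computable_on \<Phi> k (\<lambda>i xs. if P i xs then a i xs else b i xs)"
proof -
  have *: "of_bool p * x + of_bool (\<not> p) * y = (if p then x else y)" for p and x y :: nat by simp
  have "computable_on \<Phi> k (\<lambda>i xs. of_bool (P i xs) * a i xs + of_bool (\<not> P i xs) * b i xs)"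
    by (intro computable_on_add computable_on_mult computable_on_of_bool decidable_on_not assms)
  then show ?thesis unfolding * .
qed

lemma computable_on_Least:
  assumes "decidable_on \<Phi> (Suc k) (\<lambda>i ys. P i (hd ys) (tl ys))"
    and "\<And>i xs. length xs = k \<Longrightarrow> \<exists>m. P i m xs"
  shows "computable_on \<Phi> k (\<lambda>i xs. LEAST m. P i m xs)"
proof -
  have "computable_on \<Phi> k (\<lambda>i xs. LEAST m. of_bool (\<not> P i m xs) = (0::nat))"
    using decidable_on_not[OF assms(1)] assms(2)
    by (intro computable_on_Least_zero) (simp_all add: decidable_on_def)
  then show ?thesis by simp
qed

lemma decidable_on_Bex_less:
  assumes P: "decidable_on \<Phi> (Suc k) (\<lambda>i ys. P i (hd ys) (tl ys))" and n: "computable_on \<Phi> k n"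
  shows "decidable_on \<Phi> k (\<lambda>i xs. \<exists>m<n i xs. P i m xs)"
proof -
  \<comment> \<open>The disjunct \<open>b \<le> m\<close> makes the search stop at \<open>b\<close>
    at the latest; it stops strictly earlier exactly if a witness was found.\<close>
  have *: "(LEAST m. b \<le> m \<or> Q m) < b \<longleftrightarrow> (\<exists>m<b. Q m)" for b :: nat and Q
  proof
    assume "(LEAST m. b \<le> m \<or> Q m) < b"
    then show "\<exists>m<b. Q m" by (metis (mono_tags, lifting) LeastI_ex linorder_not_le order_refl)
  next
    assume "\<exists>m<b. Q m"
    then obtain m where m: "m < b" "Q m" by blast
    then have "(LEAST m. b \<le> m \<or> Q m) \<le> m" by (intro Least_le) simp
    with m show "(LEAST m. b \<le> m \<or> Q m) < b" by simp
  qed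
  have "computable_on \<Phi> k (\<lambda>i xs. LEAST m. n i xs \<le> m \<or> P i m xs)"
    by (intro computable_on_Least decidable_on_disj decidable_on_le computable_on_tl n computable_on_hd P) auto
  from decidable_on_less[OF this n] show ?thesis unfolding * .
qed

lemma decidable_on_Ball_less:
  assumes "decidable_on \<Phi> (Suc k) (\<lambda>i ys. P i (hd ys) (tl ys))" "computable_on \<Phi> k n"
  shows "decidable_on \<Phi> k (\<lambda>i xs. \<forall>m<n i xs. P i m xs)"
proof -
  have "decidable_on \<Phi> k (\<lambda>i xs. \<not> (\<exists>m<n i xs. \<not> P i m xs))"
    by (intro decidable_on_not decidable_on_Bex_less assms)
  then show ?thesis by simp
qed

lemma decidable_on_const: "decidable_on \<Phi> k (\<lambda>i xs. b)"
  unfolding decidable_on_def by (rule computable_on_const)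

lemma decidable_on_comp1:
  assumes "decidable_on \<Phi> 1 (\<lambda>i xs. P i (hd xs))" "computable_on \<Phi> k a"
  shows "decidable_on \<Phi> k (\<lambda>i xs. P i (a i xs))"
  using assms computable_on_comp1[of \<Phi> "\<lambda>i x. of_bool (P i x)"] unfolding decidable_on_def by simp

lemma decidable_on_set_decode:
  assumes "computable_on \<Phi> k a" "computable_on \<Phi> k p"
  shows "decidable_on \<Phi> k (\<lambda>i xs. a i xs \<in> set_decode (p i xs))"
proof -
  \<comment> \<open>Halving \<open>x\<close> times shifts the bit at position \<open>x\<close> of
    the code to the last place, where its parity is tested.\<close>
  have *: "rec_nat y (\<lambda>m r. r div 2) x = y div 2 ^ x" for x y :: nat
    by (induction x) (auto simp: div_mult2_eq[symmetric] mult.commute)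
  have "computable_on \<Phi> k (\<lambda>i xs. rec_nat (p i xs) (\<lambda>m r. r div 2) (a i xs))"
    by (intro computable_on_rec_nat assms computable_on_div2 computable_on_tl computable_on_hd)
  from decidable_on_odd[OF this] show ?thesis unfolding * set_decode_def by simp
qed

lemma decidable_on_finite:
  assumes "finite F" "computable_on \<Phi> k a"
  shows "decidable_on \<Phi> k (\<lambda>i xs. a i xs \<in> F)"
  using decidable_on_set_decode[OF assms(2) computable_on_const, of "set_encode F"] assms(1) by simp

section \<open>Uniform Turing reducibility\<close>

definition reducible_on :: "('i \<Rightarrow> nat set) \<Rightarrow> ('i \<Rightarrow> nat set) \<Rightarrow> bool" where
  "reducible_on \<Phi> \<Psi> \<longleftrightarrow> (\<exists>e. \<forall>i x. eval (\<Phi> i) e [x] (of_bool (x \<in> \<Psi> i)))"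

lemma reducible_on_iff: "reducible_on \<Phi> \<Psi> \<longleftrightarrow> decidable_on \<Phi> 1 (\<lambda>i xs. hd xs \<in> \<Psi> i)"
proof
  assume "reducible_on \<Phi> \<Psi>"
  then obtain e where e: "\<And>i x. eval (\<Phi> i) e [x] (of_bool (x \<in> \<Psi> i))"
    unfolding reducible_on_def by blast
  have "eval (\<Phi> i) e xs (of_bool (hd xs \<in> \<Psi> i))" if "length xs = 1" for i xs
    using e[of i "hd xs"] that by (cases xs) simp_all
  then show "decidable_on \<Phi> 1 (\<lambda>i xs. hd xs \<in> \<Psi> i)"
    unfolding decidable_on_def computable_on_def by (intro exI allI impI)
next
  show "decidable_on \<Phi> 1 (\<lambda>i xs. hd xs \<in> \<Psi> i) \<Longrightarrow> reducible_on \<Phi> \<Psi>"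
    unfolding reducible_on_def decidable_on_def computable_on_def
    by (metis One_nat_def length_Cons list.sel(1) list.size(3))
qed

lemma reducible_on_refl: "reducible_on \<Phi> \<Phi>"
  unfolding reducible_on_def by (meson eval_Oracle)

lemma decidable_on_mem:
  "reducible_on \<Phi> \<Psi> \<Longrightarrow> computable_on \<Phi> k a \<Longrightarrow> decidable_on \<Phi> k (\<lambda>i xs. a i xs \<in> \<Psi> i)"
  unfolding reducible_on_iff by (rule decidable_on_comp1)

section \<open>Substitution of oracles and transitivity\<close>

fun subst_oracle :: "recf \<Rightarrow> recf \<Rightarrow> recf" where
  "subst_oracle d Oracle = d"
| "subst_oracle d (Comp f gs) = Comp (subst_oracle d f) (map (subst_oracle d) gs)"
| "subst_oracle d (Prim f g) = Prim (subst_oracle d f) (subst_oracle d g)"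
| "subst_oracle d (Mu f) = Mu (subst_oracle d f)"
| "subst_oracle d e = e"

lemma eval_subst_oracle:
  assumes "\<And>x. eval X d [x] (of_bool (x \<in> Y))"
  shows "eval Y e xs y \<Longrightarrow> eval X (subst_oracle d e) xs y"
proof (induction rule: eval.induct)
  case (eval_Comp xs gs ys f z)
  then show ?case
    by (auto intro!: eval.eval_Comp elim!: list_all2_mono simp: list.rel_map)
next
  case (eval_Mu f n xs)
  then show ?case by (auto intro!: eval.eval_Mu)
next
  case (eval_Oracle x)
  then show ?case by (simp only: subst_oracle.simps assms)
qed (auto intro: eval.intros)

text \<open>Each query to \<open>\<Psi> i\<close> is answered by running the code \<open>d\<close>.
  The resulting code depends on \<open>d\<close> and \<open>e\<close> alone and not on the index, so
  uniformity is preserved.\<close>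

lemma computable_on_trans:
  assumes "reducible_on \<Phi> \<Psi>" "computable_on \<Psi> k h"
  shows "computable_on \<Phi> k h"
proof -
  obtain d where d: "\<forall>i x. eval (\<Phi> i) d [x] (of_bool (x \<in> \<Psi> i))"
    using assms(1) unfolding reducible_on_def ..
  obtain e where e: "\<forall>i xs. length xs = k \<longrightarrow> eval (\<Psi> i) e xs (h i xs)"
    using assms(2) unfolding computable_on_def ..
  have "eval (\<Phi> i) (subst_oracle d e) xs (h i xs)" if "length xs = k" for i xs
    by (rule eval_subst_oracle[OF d[rule_format] e[rule_format, OF that]])
  then show ?thesis unfolding computable_on_def by (intro exI allI impI)
qed

lemma reducible_on_trans: "reducible_on \<Phi> \<Psi> \<Longrightarrow> reducible_on \<Psi> \<Omega> \<Longrightarrow> reducible_on \<Phi> \<Omega>"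
  unfolding reducible_on_iff decidable_on_def
  by (rule computable_on_trans[unfolded reducible_on_iff decidable_on_def])

section \<open>Joins and plain Turing reducibility\<close>

lemma turing_join_iff: "x \<in> A \<oplus> B \<longleftrightarrow> (if even x then x div 2 \<in> A else x div 2 \<in> B)"
proof -
  have "(\<exists>n. x = 2 * n \<and> n \<in> A) \<longleftrightarrow> even x \<and> x div 2 \<in> A" by auto
  moreover have "(\<exists>n. x = 2 * n + 1 \<and> n \<in> B) \<longleftrightarrow> odd x \<and> x div 2 \<in> B"
    by (auto elim: oddE)
  ultimately show ?thesis unfolding turing_join_def by auto
qed

lemma decidable_on_join:
  assumes "decidable_on \<Phi> k (\<lambda>i xs. a i xs div 2 \<in> M i xs)" "decidable_on \<Phi> k (\<lambda>i xs. a i xs div 2 \<in> N i xs)"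
    "computable_on \<Phi> k a"
  shows "decidable_on \<Phi> k (\<lambda>i xs. a i xs \<in> M i xs \<oplus> N i xs)"
proof -
  have "decidable_on \<Phi> k (\<lambda>i xs. (even (a i xs) \<longrightarrow> a i xs div 2 \<in> M i xs)
      \<and> (odd (a i xs) \<longrightarrow> a i xs div 2 \<in> N i xs))"
    by (intro decidable_on_conj decidable_on_imp decidable_on_even decidable_on_odd assms)
  then show ?thesis by (rule decidable_on_cong) (auto simp: turing_join_iff)
qed

lemma reducible_on_join:
  assumes "reducible_on \<Phi> M" "reducible_on \<Phi> N"
  shows "reducible_on \<Phi> (\<lambda>i. M i \<oplus> N i)"
  unfolding reducible_on_iff One_nat_def
  by (intro decidable_on_join decidable_on_mem assms computable_on_div2 computable_on_hd)

lemma reducible_on_joinD: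
  assumes "reducible_on \<Phi> (\<lambda>i. M i \<oplus> N i)"
  shows "reducible_on \<Phi> M" "reducible_on \<Phi> N"
proof -
  have "decidable_on \<Phi> 1 (\<lambda>i xs. hd xs + hd xs \<in> M i \<oplus> N i)"
    "decidable_on \<Phi> 1 (\<lambda>i xs. Suc (hd xs + hd xs) \<in> M i \<oplus> N i)"
    unfolding One_nat_def by (intro decidable_on_mem assms computable_on_Suc computable_on_add computable_on_hd)+
  then show "reducible_on \<Phi> M" "reducible_on \<Phi> N"
    by (simp_all add: turing_join_iff reducible_on_iff flip: mult_2)
qed

lemmas reducible_on_left = reducible_on_joinD(1)[OF reducible_on_refl]
lemmas reducible_on_right = reducible_on_joinD(2)[OF reducible_on_refl]

lemma turing_reducible_iff: "A \<le>\<^sub>T X \<longleftrightarrow> reducible_on (\<lambda>_::unit. X) (\<lambda>_. A)"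
  unfolding turing_reducible_def computable_in_def reducible_on_def by simp

lemma reducible_on_const: "A \<le>\<^sub>T X \<Longrightarrow> reducible_on (\<lambda>_. X) (\<lambda>_. A)"
  unfolding turing_reducible_def computable_in_def reducible_on_def by simp

lemma turing_reducible_trans: "A \<le>\<^sub>T B \<Longrightarrow> B \<le>\<^sub>T C \<Longrightarrow> A \<le>\<^sub>T C"
  unfolding turing_reducible_iff by (rule reducible_on_trans)

lemma turing_reducible_refl: "A \<le>\<^sub>T A"
  unfolding turing_reducible_iff by (rule reducible_on_refl)

lemma turing_reducible_join_iff: "A \<oplus> B \<le>\<^sub>T C \<longleftrightarrow> A \<le>\<^sub>T C \<and> B \<le>\<^sub>T C"
  unfolding turing_reducible_iff 
  using reducible_on_join[of "\<lambda>_::unit. C" "\<lambda>_. A" "\<lambda>_. B"]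
    reducible_on_joinD[of "\<lambda>_::unit. C" "\<lambda>_. A" "\<lambda>_. B"] by blast

lemma computable_in_iff: "computable_in X f \<longleftrightarrow> computable_on (\<lambda>_::unit. X) 1 (\<lambda>_ xs. f (hd xs))"
proof -
  have *: "(\<forall>(i::unit) xs. length xs = 1 \<longrightarrow> P xs) \<longleftrightarrow> (\<forall>x. P [x])" for P :: "nat list \<Rightarrow> bool"
    by (auto simp: length_Suc_conv)
  show ?thesis unfolding computable_in_def computable_on_def * by simp
qed

section \<open>Step-bounded evaluation\<close>

text \<open>
  \<open>ev Z s e xs\<close> is \<open>0\<close> for a computation that has not converged within \<open>s\<close> steps and \<open>Suc y\<close> for one
  with value \<open>y\<close>.  Only unbounded search and oracle queries need the bound \<open>s\<close>; bounding the queries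
  makes the dependence on the oracle finite.
\<close>

fun ev :: "nat set \<Rightarrow> nat \<Rightarrow> recf \<Rightarrow> nat list \<Rightarrow> nat" where
  "ev Z s Zero xs = 1"
| "ev Z s Succ xs = (case xs of [x] \<Rightarrow> Suc (Suc x) | _ \<Rightarrow> 0)"
| "ev Z s (Proj i) xs = (if i < length xs then Suc (xs ! i) else 0)"
| "ev Z s Oracle xs = (case xs of [x] \<Rightarrow> if x < s then Suc (of_bool (x \<in> Z)) else 0 | _ \<Rightarrow> 0)"
| "ev Z s (Comp f gs) xs = (if \<exists>g\<in>set gs. ev Z s g xs = 0 then 0
    else ev Z s f (map (\<lambda>g. ev Z s g xs - 1) gs))"
| "ev Z s (Prim f g) xs = (case xs of [] \<Rightarrow> 0 | n # xs \<Rightarrow>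
    rec_nat (ev Z s f xs) (\<lambda>m r. if r = 0 then 0 else ev Z s g (m # (r - 1) # xs)) n)"
| "ev Z s (Mu f) xs = (let m = LEAST m. s \<le> m \<or> ev Z s f (m # xs) \<le> 1
    in if m < s \<and> ev Z s f (m # xs) = 1 then Suc m else 0)"

text \<open>Values of \<open>ev\<close> are shifted by one: 1 means convergence to 0, and anything
  larger means convergence to a positive number. The right-hand side is therefore the rule
  \<open>eval_Mu\<close> with the search cut off at \<open>s\<close>.\<close>

lemma ev_Mu_iff:
  "ev Z s (Mu f) xs = Suc n \<longleftrightarrow> n < s \<and> ev Z s f (n # xs) = 1 \<and> (\<forall>m<n. ev Z s f (m # xs) > 1)"
  (is "?l \<longleftrightarrow> ?r")
proof
  let ?P = "\<lambda>m. s \<le> m \<or> ev Z s f (m # xs) \<le> 1"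
  assume ?l
  then have n: "n = (LEAST m. ?P m)" "n < s" "ev Z s f (n # xs) = 1"
    by (auto simp: Let_def split: if_splits)
  have "ev Z s f (m # xs) > 1" if "m < n" for m
    using that not_less_Least[of m ?P] unfolding n(1) by simp
  then show ?r using n(2,3) by blast
next
  assume r: ?r
  have "(LEAST m. s \<le> m \<or> ev Z s f (m # xs) \<le> 1) = n"
  proof (rule Least_equality)
    show "n \<le> m" if "s \<le> m \<or> ev Z s f (m # xs) \<le> 1" for m
      using that r by (metis less_imp_le_nat linorder_not_le order_trans)
  qed (use r in simp)
  then show ?l using r by (simp add: Let_def)
qed

lemma ev_sound: "ev Z s e xs = Suc y \<Longrightarrow> eval Z e xs y"
proof (induction e arbitrary: xs y)
  case (Comp f gs)
  have 1: "\<forall>g\<in>set gs. ev Z s g xs \<noteq> 0" and 2: "ev Z s f (map (\<lambda>g. ev Z s g xs - 1) gs) = Suc y"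
    using Comp.prems by (auto split: if_splits)
  show ?case
  proof (rule eval_Comp)
    show "list_all2 (\<lambda>g y. eval Z g xs y) gs (map (\<lambda>g. ev Z s g xs - 1) gs)"
      using 1 Comp.IH(2) by (auto simp: list_all2_conv_all_nth)
    show "eval Z f (map (\<lambda>g. ev Z s g xs - 1) gs) y" using 2 by (rule Comp.IH(1))
  qed
next
  case (Prim f g)
  then obtain n zs where xs: "xs = n # zs" by (auto split: list.splits)
  have "eval Z (Prim f g) (n # zs) y"
    if "rec_nat (ev Z s f zs) (\<lambda>m r. if r = 0 then 0 else ev Z s g (m # (r - 1) # zs)) n = Suc y"
    using that
  proof (induction n arbitrary: y)
    case 0
    then show ?case using Prim.IH(1) by (auto intro: eval_Prim_0)
  next
    case (Suc n)
    let ?r = "rec_nat (ev Z s f zs) (\<lambda>m r. if r = 0 then 0 else ev Z s g (m # (r - 1) # zs)) n"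
    have "?r \<noteq> 0" and g: "ev Z s g (n # (?r - 1) # zs) = Suc y"
      using Suc.prems by (auto split: if_splits)
    then have "eval Z (Prim f g) (n # zs) (?r - 1)" using Suc.IH by simp
    then show ?case using Prim.IH(2)[OF g] by (rule eval_Prim_Suc)
  qed
  then show ?case using Prim.prems xs by simp
next
  case (Mu f)
  have *: "ev Z s f (y # xs) = 1" "\<forall>m<y. ev Z s f (m # xs) > 1"
    using Mu.prems unfolding ev_Mu_iff by auto
  show ?case
  proof (rule eval_Mu)
    show "eval Z f (y # xs) 0" using *(1) Mu.IH by simp
    show "\<forall>m<y. \<exists>k. eval Z f (m # xs) (Suc k)"
    proof (intro allI impI)
      fix m assume "m < y"
      then have "1 < ev Z s f (m # xs)" using *(2) by blast
      then obtain k where "ev Z s f (m # xs) = Suc (Suc k)" by (metis One_nat_def less_iff_Suc_add plus_1_eq_Suc)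
      then show "\<exists>k. eval Z f (m # xs) (Suc k)" using Mu.IH by blast
    qed
  qed
qed (auto split: list.splits if_splits intro: eval.intros)

lemma ev_mono: "s \<le> t \<Longrightarrow> ev Z s e xs = Suc y \<Longrightarrow> ev Z t e xs = Suc y"
proof (induction e arbitrary: xs y)
  case (Comp f gs)
  have 1: "\<forall>g\<in>set gs. ev Z s g xs \<noteq> 0" and 2: "ev Z s f (map (\<lambda>g. ev Z s g xs - 1) gs) = Suc y"
    using Comp.prems by (auto split: if_splits)
  have g: "ev Z t g xs = ev Z s g xs" if "g \<in> set gs" for g
    using 1 Comp.IH(2)[OF that Comp.prems(1)] that by (metis not0_implies_Suc)
  then have *: "map (\<lambda>g. ev Z t g xs - 1) gs = map (\<lambda>g. ev Z s g xs - 1) gs" by simp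
  have "ev Z t f (map (\<lambda>g. ev Z t g xs - 1) gs) = Suc y"
    unfolding * by (rule Comp.IH(1)[OF Comp.prems(1) 2])
  then show ?case using 1 g by simp
next
  case (Prim f g)
  then obtain n zs where xs: "xs = n # zs" by (auto split: list.splits)
  let ?R = "\<lambda>s. rec_nat (ev Z s f zs) (\<lambda>m r. if r = 0 then 0 else ev Z s g (m # (r - 1) # zs))"
  have "?R s n = Suc y \<Longrightarrow> ?R t n = Suc y"
  proof (induction n arbitrary: y)
    case 0
    then show ?case using Prim.IH(1)[OF Prim.prems(1)] by simp
  next
    case (Suc n)
    have "?R s n \<noteq> 0" and g: "ev Z s g (n # (?R s n - 1) # zs) = Suc y"
      using Suc.prems by (auto split: if_splits)
    then obtain r where r: "?R s n = Suc r" using not0_implies_Suc by blast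
    show ?case using Suc.IH[OF r] Prim.IH(2)[OF Prim.prems(1) g] r by simp
  qed
  then show ?case using Prim.prems xs by simp
next
  case (Mu f)
  have *: "y < s" "ev Z s f (y # xs) = Suc 0" "\<forall>m<y. ev Z s f (m # xs) > 1"
    using Mu.prems(2) unfolding ev_Mu_iff by auto
  have "ev Z t f (m # xs) > 1" if "m < y" for m
  proof -
    have "1 < ev Z s f (m # xs)" using *(3) that by blast
    then obtain k where "ev Z s f (m # xs) = Suc (Suc k)" by (metis One_nat_def less_iff_Suc_add plus_1_eq_Suc)
    then show ?thesis using Mu.IH[OF Mu.prems(1)] by simp
  qed
  then show ?case unfolding ev_Mu_iff using * Mu.IH[OF Mu.prems(1) *(2)] Mu.prems(1) by simp
qed (auto split: list.splits if_splits)

lemma ev_complete: "eval Z e xs y \<Longrightarrow> \<exists>s. ev Z s e xs = Suc y"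
proof (induction rule: eval.induct)
  case (eval_Oracle x)
  have "ev Z (Suc x) Oracle [x] = Suc (of_bool (x \<in> Z))" by simp
  then show ?case by blast
next
  case (eval_Comp xs gs ys f z)
  obtain s0 where s0: "ev Z s0 f ys = Suc z" using eval_Comp.IH(2) by blast
  have "\<forall>i<length gs. \<exists>s. ev Z s (gs ! i) xs = Suc (ys ! i)"
    using eval_Comp.IH(1) by (auto simp: list_all2_conv_all_nth)
  then obtain S where S: "\<And>i. i < length gs \<Longrightarrow> ev Z (S i) (gs ! i) xs = Suc (ys ! i)" by metis
  \<comment> \<open>A sum of stages bounds each of them, so by monotonicity all subcomputations have
    converged by \<open>s\<close>.\<close>
  define s where "s = s0 + sum S {..<length gs}"
  have "S i \<le> s" if "i < length gs" for i
    unfolding s_def using that member_le_sum[of i "{..<length gs}" S] by simp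
  then have g: "ev Z s (gs ! i) xs = Suc (ys ! i)" if "i < length gs" for i
    using that S ev_mono by blast
  have l: "length ys = length gs" using eval_Comp.IH(1) by (simp add: list_all2_conv_all_nth)
  have "map (\<lambda>g. ev Z s g xs - 1) gs = ys" using g l by (intro nth_equalityI) simp_all
  moreover have "\<not> (\<exists>g\<in>set gs. ev Z s g xs = 0)" using g by (auto simp: in_set_conv_nth)
  moreover have "ev Z s f ys = Suc z" using s0 by (rule ev_mono[rotated]) (simp add: s_def)
  ultimately show ?case by (intro exI[of _ s]) simp
next
  case (eval_Prim_Suc f g n xs r y)
  then obtain s t where st: "ev Z s (Prim f g) (n # xs) = Suc r" "ev Z t g (n # r # xs) = Suc y" by blast
  have "ev Z (max s t) (Prim f g) (n # xs) = Suc r" "ev Z (max s t) g (n # r # xs) = Suc y"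
    by (rule ev_mono[OF _ st(1)] ev_mono[OF _ st(2)], simp)+
  then have "ev Z (max s t) (Prim f g) (Suc n # xs) = Suc y" by simp
  then show ?case by blast
next
  case (eval_Mu f n xs)
  obtain s0 where s0: "ev Z s0 f (n # xs) = Suc 0" using eval_Mu.IH(1) by blast
  have "\<forall>m<n. \<exists>s k. ev Z s f (m # xs) = Suc (Suc k)" using eval_Mu.IH(2) by blast
  then obtain S K where S: "\<And>m. m < n \<Longrightarrow> ev Z (S m) f (m # xs) = Suc (Suc (K m))" by metis
  \<comment> \<open>The summand \<open>Suc n\<close> keeps the result \<open>n\<close> below the
    cut-off of the search.\<close>
  define s where "s = Suc n + s0 + sum S {..<n}"
  have "S i \<le> s" if "i < n" for i
    unfolding s_def using that member_le_sum[of i "{..<n}" S] by simp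
  then have "ev Z s f (m # xs) = Suc (Suc (K m))" if "m < n" for m
    using that S ev_mono by blast
  moreover have "ev Z s f (n # xs) = Suc 0" using s0 by (rule ev_mono[rotated]) (simp add: s_def)
  ultimately have "ev Z s (Mu f) xs = Suc n" unfolding ev_Mu_iff by (simp add: s_def)
  then show ?case by blast
qed auto

lemma eval_iff_ev: "eval Z e xs y \<longleftrightarrow> (\<exists>s. ev Z s e xs = Suc y)"
  using ev_sound ev_complete by blast

lemma halts_iff_ev: "(\<exists>y. eval Z e xs y) \<longleftrightarrow> (\<exists>s. ev Z s e xs \<noteq> 0)"
  unfolding eval_iff_ev by (metis not0_implies_Suc nat.simps(3))

text \<open>Use principle: a query at or above \<open>s\<close> counts as not converged, so the
  oracle is consulted only below \<open>s\<close>.\<close>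

lemma ev_cong:
  assumes "\<And>x. x < s \<Longrightarrow> x \<in> Z \<longleftrightarrow> x \<in> Z'"
  shows "ev Z s e xs = ev Z' s e xs"
proof (induction e arbitrary: xs)
  case (Prim f g)
  then show ?case by (cases xs) (simp_all cong: if_cong)
next
  case (Comp f gs)
  have "map (\<lambda>g. ev Z s g xs - 1) gs = map (\<lambda>g. ev Z' s g xs - 1) gs" using Comp.IH(2) by simp
  then show ?case unfolding ev.simps using Comp.IH by (metis (no_types, lifting))
next
  case Oracle
  then show ?case using assms by (auto split: list.splits)
qed simp_all

text \<open>The oracle may vary with a computed parameter \<open>p\<close>, for instance a coded
  finite set; \<open>Z\<close> only has to be decidable in \<open>p\<close>. The induction on the
  code generalises over the argument functions \<open>gs\<close>, as subcodes are run on other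
  arguments, and over \<open>k\<close>, \<open>p\<close> and \<open>s\<close>, as recursion and
  search enlarge the context.\<close>

lemma computable_on_ev:
  assumes Z: "\<And>k a p. computable_on \<Phi> k a \<Longrightarrow> computable_on \<Phi> k p \<Longrightarrow>
      decidable_on \<Phi> k (\<lambda>i xs. a i xs \<in> Z i (p i xs))"
  shows "computable_on \<Phi> k p \<Longrightarrow> computable_on \<Phi> k s \<Longrightarrow> (\<And>g. g \<in> set gs \<Longrightarrow> computable_on \<Phi> k g) \<Longrightarrow>
    computable_on \<Phi> k (\<lambda>i xs. ev (Z i (p i xs)) (s i xs) e (map (\<lambda>g. g i xs) gs))"
proof (induction e arbitrary: k p s gs)
  case Zero
  then show ?case by (simp add: computable_on_const)
next
  case Succ
  show ?case
  proof (cases "length gs = 1")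
    case True
    then obtain g where "gs = [g]" by (auto simp: length_Suc_conv)
    then show ?thesis using Succ by (simp add: computable_on_Suc)
  next
    case False
    then have "ev (Z i (p i xs)) (s i xs) Succ (map (\<lambda>g. g i xs) gs) = 0" for i xs
      by (auto split: list.splits)
    then show ?thesis by (simp only: computable_on_const)
  qed
next
  case (Proj j)
  then show ?case by (cases "j < length gs") (simp_all add: computable_on_const computable_on_Suc)
next
  case Oracle
  show ?case
  proof (cases "length gs = 1")
    case True
    then obtain g where g: "gs = [g]" by (auto simp: length_Suc_conv)
    have "computable_on \<Phi> k (\<lambda>i xs. if g i xs < s i xs then Suc (of_bool (g i xs \<in> Z i (p i xs))) else 0)"
      using Oracle g
      by (intro computable_on_if computable_on_Suc decidable_on_less computable_on_of_bool Z computable_on_const) simp_all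
    then show ?thesis using g by simp
  next
    case False
    then have "ev (Z i (p i xs)) (s i xs) Oracle (map (\<lambda>g. g i xs) gs) = 0" for i xs
      by (auto split: list.splits)
    then show ?thesis by (simp only: computable_on_const)
  qed
next
  case (Comp f hs)
  let ?h = "\<lambda>h i xs. ev (Z i (p i xs)) (s i xs) h (map (\<lambda>g. g i xs) gs)"
  have h: "computable_on \<Phi> k (?h h)" if "h \<in> set hs" for h
    using that Comp.prems by (intro Comp.IH(2)) simp_all
  have "decidable_on \<Phi> k (\<lambda>i xs. \<exists>h\<in>set hs'. ?h h i xs = 0)" if "set hs' \<subseteq> set hs" for hs'
    using that
  proof (induction hs')
    case Nil
    then show ?case by (simp add: decidable_on_const)
  next
    case (Cons h hs')
    have "decidable_on \<Phi> k (\<lambda>i xs. ?h h i xs = 0 \<or> (\<exists>h\<in>set hs'. ?h h i xs = 0))"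
      using Cons by (intro decidable_on_disj decidable_on_eq computable_on_const h) simp_all
    then show ?case by simp
  qed
  from this[of hs]
  have d: "decidable_on \<Phi> k (\<lambda>i xs. \<exists>h\<in>set hs. ?h h i xs = 0)" by simp
  have "computable_on \<Phi> k (\<lambda>i xs. ev (Z i (p i xs)) (s i xs) f (map (\<lambda>g. g i xs) (map (\<lambda>h i xs. ?h h i xs - 1) hs)))"
    using Comp.prems h by (intro Comp.IH(1)) (auto intro!: computable_on_pred[unfolded One_nat_def])
  then have "computable_on \<Phi> k (\<lambda>i xs. if \<exists>h\<in>set hs. ?h h i xs = 0 then 0
      else ev (Z i (p i xs)) (s i xs) f (map (\<lambda>g. g i xs) (map (\<lambda>h i xs. ?h h i xs - 1) hs)))"
    by (intro computable_on_if d computable_on_const)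
  then show ?case by (simp add: comp_def cong: if_cong)
next
  case (Prim f g)
  show ?case
  proof (cases gs)
    case Nil
    then show ?thesis by (simp add: computable_on_const)
  next
    case (Cons n hs)
    \<comment> \<open>Arguments of the step code in a context with two new variables: the counter,
      the previous value with the shift of \<open>ev\<close> undone, and the old parameters.\<close>
    let ?hs = "(\<lambda>i ys. hd ys) # (\<lambda>i ys. hd (tl ys) - 1) # map (\<lambda>h i ys. h i (tl (tl ys))) hs"
    have p2: "computable_on \<Phi> (Suc (Suc k)) (\<lambda>i ys. q i (tl (tl ys)))" if "computable_on \<Phi> k q" for q
      using computable_on_tl[OF computable_on_tl[OF that]] by simp
    have "computable_on \<Phi> (Suc (Suc k)) (\<lambda>i ys. ev (Z i (p i (tl (tl ys)))) (s i (tl (tl ys))) g (map (\<lambda>h. h i ys) ?hs))"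
    proof (rule Prim.IH(2)[OF p2[OF Prim.prems(1)] p2[OF Prim.prems(2)]])
      fix h assume "h \<in> set ?hs"
      then consider "h = (\<lambda>i ys. hd ys)" | "h = (\<lambda>i ys. hd (tl ys) - 1)"
        | q where "q \<in> set hs" "h = (\<lambda>i ys. q i (tl (tl ys)))" by auto
      then show "computable_on \<Phi> (Suc (Suc k)) h"
      proof cases
        case 1
        then show ?thesis by (simp add: computable_on_hd)
      next
        case 2
        show ?thesis unfolding 2 by (intro computable_on_pred computable_on_tl computable_on_hd)
      next
        case 3
        then show ?thesis using Prim.prems(3) Cons p2 by simp
      qed
    qed
    then have g: "computable_on \<Phi> (Suc (Suc k)) (\<lambda>i ys. ev (Z i (p i (tl (tl ys)))) (s i (tl (tl ys))) g
        (hd ys # (hd (tl ys) - 1) # map (\<lambda>h. h i (tl (tl ys))) hs))"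
      by (simp add: comp_def)
    have "computable_on \<Phi> k (\<lambda>i xs. rec_nat (ev (Z i (p i xs)) (s i xs) f (map (\<lambda>g. g i xs) hs))
      (\<lambda>m r. if r = 0 then 0 else ev (Z i (p i xs)) (s i xs) g (m # (r - 1) # map (\<lambda>h. h i xs) hs)) (n i xs))"
    proof (intro computable_on_rec_nat computable_on_if decidable_on_eq computable_on_const g)
      show "computable_on \<Phi> k n" using Prim.prems(3) Cons by simp
      show "computable_on \<Phi> k (\<lambda>i xs. ev (Z i (p i xs)) (s i xs) f (map (\<lambda>g. g i xs) hs))"
        using Prim.prems Cons by (intro Prim.IH(1)) simp_all
      show "computable_on \<Phi> (Suc (Suc k)) (\<lambda>i ys. hd (tl ys))"
        by (intro computable_on_tl computable_on_hd)
    qed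
    then show ?thesis using Cons by simp
  qed
next
  case (Mu f)
  have f: "computable_on \<Phi> k (\<lambda>i xs. ev (Z i (p i xs)) (s i xs) f (m i xs # map (\<lambda>g. g i xs) gs))"
    if "computable_on \<Phi> k p" "computable_on \<Phi> k s" "computable_on \<Phi> k m"
      "\<And>g. g \<in> set gs \<Longrightarrow> computable_on \<Phi> k g" for k p s m gs
  proof -
    have "computable_on \<Phi> k (\<lambda>i xs. ev (Z i (p i xs)) (s i xs) f (map (\<lambda>g. g i xs) (m # gs)))"
      using that by (intro Mu.IH) auto
    then show ?thesis by simp
  qed
  have "computable_on \<Phi> (Suc k) (\<lambda>i ys. ev (Z i (p i (tl ys))) (s i (tl ys)) f
      (hd ys # map (\<lambda>g. g i ys) (map (\<lambda>g i ys. g i (tl ys)) gs)))"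
    using Mu.prems by (intro f computable_on_tl computable_on_hd) (auto intro: computable_on_tl)
  then have f': "computable_on \<Phi> (Suc k) (\<lambda>i ys. ev (Z i (p i (tl ys))) (s i (tl ys)) f
      (hd ys # map (\<lambda>g. g i (tl ys)) gs))"
    by (simp add: comp_def)
  let ?m = "\<lambda>i xs. LEAST m. s i xs \<le> m \<or> ev (Z i (p i xs)) (s i xs) f (m # map (\<lambda>g. g i xs) gs) \<le> 1"
  have m: "computable_on \<Phi> k ?m"
    by (intro computable_on_Least decidable_on_disj decidable_on_le f' computable_on_const computable_on_hd
      computable_on_tl Mu.prems) auto
  have "computable_on \<Phi> k (\<lambda>i xs. if ?m i xs < s i xs \<and>
      ev (Z i (p i xs)) (s i xs) f (?m i xs # map (\<lambda>g. g i xs) gs) = 1 then Suc (?m i xs) else 0)"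
    by (intro computable_on_if decidable_on_conj decidable_on_less decidable_on_eq f m computable_on_const
      computable_on_Suc Mu.prems)
  then show ?case unfolding ev.simps Let_def .
qed

section \<open>Semidecidability and compactness of Cantor space\<close>

definition semidecidable_on :: "('i \<Rightarrow> nat set) \<Rightarrow> nat \<Rightarrow> ('i \<Rightarrow> nat list \<Rightarrow> bool) \<Rightarrow> bool" where
  "semidecidable_on \<Phi> k R \<longleftrightarrow> (\<exists>e. \<forall>i xs. length xs = k \<longrightarrow> (R i xs \<longleftrightarrow> (\<exists>y. eval (\<Phi> i) e xs y)))"

lemma semidecidable_on_Ex:
  assumes "decidable_on \<Phi> (Suc k) (\<lambda>i ys. P i (hd ys) (tl ys))"
  shows "semidecidable_on \<Phi> k (\<lambda>i xs. \<exists>w. P i w xs)"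
proof -
  \<comment> \<open>\<open>Mu\<close> looks for the value 0, hence the negated predicate.\<close>
  obtain e where e: "\<forall>i ys. length ys = Suc k \<longrightarrow> eval (\<Phi> i) e ys (of_bool (\<not> P i (hd ys) (tl ys)))"
    using decidable_on_not[OF assms] unfolding decidable_on_def computable_on_def ..
  have e': "eval (\<Phi> i) e (w # xs) (of_bool (\<not> P i w xs))" if "length xs = k" for i w xs
    using e[rule_format, of "w # xs" i] that by simp
  have "(\<exists>w. P i w xs) \<longleftrightarrow> (\<exists>y. eval (\<Phi> i) (Mu e) xs y)" if k: "length xs = k" for i xs
  proof
    assume "\<exists>w. P i w xs"
    then have P: "P i (LEAST w. P i w xs) xs" by (rule LeastI_ex)
    have "eval (\<Phi> i) (Mu e) xs (LEAST w. P i w xs)"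
    proof (rule eval_Mu)
      show "eval (\<Phi> i) e ((LEAST w. P i w xs) # xs) 0" using e'[OF k, of i "LEAST w. P i w xs"] P by simp
      show "\<forall>m<LEAST w. P i w xs. \<exists>j. eval (\<Phi> i) e (m # xs) (Suc j)"
      proof (intro allI impI)
        fix m assume "m < (LEAST w. P i w xs)"
        then have "\<not> P i m xs" by (rule not_less_Least)
        then show "\<exists>j. eval (\<Phi> i) e (m # xs) (Suc j)" using e'[OF k, of i m] by auto
      qed
    qed
    then show "\<exists>y. eval (\<Phi> i) (Mu e) xs y" ..
  next
    assume "\<exists>y. eval (\<Phi> i) (Mu e) xs y"
    then obtain y where "eval (\<Phi> i) e (y # xs) 0" by (auto elim: eval.cases)
    with e'[OF k, of i y] have "of_bool (\<not> P i y xs) = (0::nat)" by (rule eval_deterministic)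
    then have "P i y xs" by simp
    then show "\<exists>w. P i w xs" ..
  qed
  then show ?thesis unfolding semidecidable_on_def by (intro exI allI impI)
qed

lemma semidecidable_on_cong:
  assumes "semidecidable_on \<Phi> k R" "\<And>i xs. length xs = k \<Longrightarrow> R i xs \<longleftrightarrow> R' i xs"
  shows "semidecidable_on \<Phi> k R'"
  using assms unfolding semidecidable_on_def by simp

lemma ev_self_computable:
  assumes "computable_on \<Phi> k s" "\<And>g. g \<in> set gs \<Longrightarrow> computable_on \<Phi> k g"
  shows "computable_on \<Phi> k (\<lambda>i xs. ev (\<Phi> i) (s i xs) e (map (\<lambda>g. g i xs) gs))"
  by (rule computable_on_ev[of \<Phi> "\<lambda>i _. \<Phi> i" k "\<lambda>i xs. 0"])
    (intro decidable_on_mem reducible_on_refl computable_on_const assms | assumption)+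

lemma computable_on_tl_nth: "j < k \<Longrightarrow> computable_on \<Phi> (Suc k) (\<lambda>i xs. tl xs ! j)"
  by (rule computable_on_tl[OF computable_on_nth])

lemma map_nth_upt: "length xs = k \<Longrightarrow> map (\<lambda>j. xs ! j) [0..<k] = xs"
  by (auto intro: nth_equalityI)

text \<open>Converse of \<open>semidecidable_on_Ex\<close>: the witness searched for is a number of
  steps within which the computation halts.\<close>

lemma semidecidable_on_stages:
  assumes "semidecidable_on \<Phi> k R"
  shows "\<exists>P. decidable_on \<Phi> (Suc k) (\<lambda>i ys. P i (hd ys) (tl ys)) \<and>
    (\<forall>i xs. length xs = k \<longrightarrow> (R i xs \<longleftrightarrow> (\<exists>s. P i s xs)))"
proof -
  obtain e where e: "\<forall>i xs. length xs = k \<longrightarrow> (R i xs \<longleftrightarrow> (\<exists>y. eval (\<Phi> i) e xs y))"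
    using assms unfolding semidecidable_on_def ..
  let ?gs = "map (\<lambda>j (i::'a) ys. tl ys ! j) [0..<k]"
  have "decidable_on \<Phi> (Suc k) (\<lambda>i ys. ev (\<Phi> i) (hd ys) e (map (\<lambda>g. g i ys) ?gs) \<noteq> 0)"
    by (intro decidable_on_not decidable_on_eq computable_on_const ev_self_computable computable_on_hd)
      (auto intro: computable_on_tl_nth)
  then have "decidable_on \<Phi> (Suc k) (\<lambda>i ys. ev (\<Phi> i) (hd ys) e (tl ys) \<noteq> 0)"
    by (rule decidable_on_cong) (simp add: comp_def map_nth_upt)
  moreover have "R i xs \<longleftrightarrow> (\<exists>s. ev (\<Phi> i) s e xs \<noteq> 0)" if "length xs = k" for i xs
    using e[rule_format, OF that] halts_iff_ev by simp
  ultimately show ?thesis by (intro exI[of _ "\<lambda>i s xs. ev (\<Phi> i) s e xs \<noteq> 0"] conjI) simp_all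
qed

lemma semidecidable_on_disj:
  assumes "semidecidable_on \<Phi> k R" "semidecidable_on \<Phi> k R'"
  shows "semidecidable_on \<Phi> k (\<lambda>i xs. R i xs \<or> R' i xs)"
proof -
  obtain P where P: "decidable_on \<Phi> (Suc k) (\<lambda>i ys. P i (hd ys) (tl ys)) \<and>
    (\<forall>i xs. length xs = k \<longrightarrow> (R i xs \<longleftrightarrow> (\<exists>s. P i s xs)))"
    using semidecidable_on_stages[OF assms(1)] ..
  obtain P' where P': "decidable_on \<Phi> (Suc k) (\<lambda>i ys. P' i (hd ys) (tl ys)) \<and>
    (\<forall>i xs. length xs = k \<longrightarrow> (R' i xs \<longleftrightarrow> (\<exists>s. P' i s xs)))"
    using semidecidable_on_stages[OF assms(2)] ..
  have "semidecidable_on \<Phi> k (\<lambda>i xs. \<exists>s. P i s xs \<or> P' i s xs)"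
    by (intro semidecidable_on_Ex decidable_on_disj P[THEN conjunct1] P'[THEN conjunct1])
  then show ?thesis using P P' by (elim semidecidable_on_cong) (simp add: ex_disj_distrib)
qed

lemma semidecidable_on_comp:
  assumes R: "semidecidable_on \<Phi> (length gs) R" and gs: "\<And>g. g \<in> set gs \<Longrightarrow> computable_on \<Phi> k g"
  shows "semidecidable_on \<Phi> k (\<lambda>i xs. R i (map (\<lambda>g. g i xs) gs))"
proof -
  obtain P where P: "decidable_on \<Phi> (Suc (length gs)) (\<lambda>i ys. P i (hd ys) (tl ys)) \<and>
    (\<forall>i xs. length xs = length gs \<longrightarrow> (R i xs \<longleftrightarrow> (\<exists>s. P i s xs)))"
    using semidecidable_on_stages[OF R] ..
  let ?gs = "(\<lambda>i ys. hd ys) # map (\<lambda>g i ys. g i (tl ys)) gs"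
  have "computable_on \<Phi> (Suc k) (\<lambda>i ys. (\<lambda>i ys. of_bool (P i (hd ys) (tl ys))) i (map (\<lambda>g. g i ys) ?gs))"
    using P[THEN conjunct1] gs unfolding decidable_on_def
    by (intro computable_on_comp) (auto intro: computable_on_hd computable_on_tl)
  then have "decidable_on \<Phi> (Suc k) (\<lambda>i ys. P i (hd ys) (map (\<lambda>g. g i (tl ys)) gs))"
    by (simp add: decidable_on_def comp_def)
  from semidecidable_on_Ex[of \<Phi> k "\<lambda>i w xs. P i w (map (\<lambda>g. g i xs) gs)", OF this]
  show ?thesis by (rule semidecidable_on_cong) (simp add: P)
qed

lemma semidecidable_on_pair:
  assumes "semidecidable_on \<Phi> 2 R"
  shows "semidecidable_on \<Phi> k (\<lambda>i xs. R i [a, b])"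
proof -
  have "semidecidable_on \<Phi> k (\<lambda>i xs. R i (map (\<lambda>g. g i xs) [\<lambda>_ _. a, \<lambda>_ _. b]))"
    using assms by (intro semidecidable_on_comp) (auto simp: numeral_2_eq_2 computable_on_const)
  then show ?thesis by simp
qed

text \<open>Searches at once for an admissible parameter \<open>p\<close> and for a halting
  computation with the oracle given by \<open>p\<close>. In the applications \<open>p\<close> codes
  a finite extension of a stem.\<close>

lemma semidecidable_on_eval:
  assumes Z: "\<And>k a p. computable_on \<Phi> k a \<Longrightarrow> computable_on \<Phi> k p \<Longrightarrow>
      decidable_on \<Phi> k (\<lambda>i xs. a i xs \<in> Z i (p i xs))"
    and Q: "decidable_on \<Phi> (Suc 0) (\<lambda>i xs. Q i (hd xs))"
  shows "semidecidable_on \<Phi> 2 (\<lambda>i xs. \<exists>p. Q i p \<and> eval (Z i p) e [hd xs] (hd (tl xs)))"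
proof -
  have Q': "computable_on \<Phi> k a \<Longrightarrow> decidable_on \<Phi> k (\<lambda>i xs. Q i (a i xs))" for k a
    using decidable_on_comp1[of \<Phi> Q] Q by simp
  \<comment> \<open>A common bound \<open>w\<close> on \<open>p\<close> and on the number of steps
    reduces the two unbounded searches to one.\<close>
  have "semidecidable_on \<Phi> (Suc (Suc 0)) (\<lambda>i xs. \<exists>w. \<exists>p<w. \<exists>s<w.
      Q i p \<and> ev (Z i p) s e (map (\<lambda>g. g i xs) [\<lambda>i xs. hd xs]) = Suc (hd (tl xs)))"
  proof (intro semidecidable_on_Ex decidable_on_Bex_less decidable_on_conj decidable_on_eq computable_on_Suc
      computable_on_tl computable_on_hd Q')
    have "computable_on \<Phi> (Suc (Suc (Suc (Suc (Suc 0))))) (\<lambda>i ys. ev (Z i (hd (tl ys))) (hd ys) e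
        (map (\<lambda>g. g i ys) [\<lambda>i ys. hd (tl (tl (tl ys)))]))"
      by (intro computable_on_ev Z) (auto intro!: computable_on_tl computable_on_hd)
    then show "computable_on \<Phi> (Suc (Suc (Suc (Suc (Suc 0))))) (\<lambda>i ys. ev (Z i (hd (tl ys))) (hd ys) e
        (map (\<lambda>g. g i (tl (tl (tl ys)))) [\<lambda>i ys. hd ys]))" by simp
  qed
  then show ?thesis unfolding numeral_2_eq_2
  proof (rule semidecidable_on_cong)
    fix i and xs :: "nat list"
    let ?P = "\<lambda>p s. Q i p \<and> ev (Z i p) s e [hd xs] = Suc (hd (tl xs))"
    have "(\<exists>w. \<exists>p<w. \<exists>s<w. ?P p s) \<longleftrightarrow> (\<exists>p s. ?P p s)"
      by (meson less_Suc_eq_le max.cobounded1 max.cobounded2)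
    then show "(\<exists>w. \<exists>p<w. \<exists>s<w. Q i p \<and> ev (Z i p) s e (map (\<lambda>g. g i xs) [\<lambda>i xs. hd xs]) = Suc (hd (tl xs)))
      \<longleftrightarrow> (\<exists>p. Q i p \<and> eval (Z i p) e [hd xs] (hd (tl xs)))"
      by (auto simp: eval_iff_ev)
  qed
qed

text \<open>Weak Koenig's lemma. By \<open>anti\<close> and \<open>loc\<close> the sets satisfying
  \<open>Q s\<close> form a decreasing sequence of clopen classes; a path through the binary tree of
  good initial segments lies in all of them.\<close>

lemma cantor_compact:
  fixes Q :: "nat \<Rightarrow> nat set \<Rightarrow> bool"
  assumes ne: "\<And>s. \<exists>S. Q s S"
    and anti: "\<And>s t S. s \<le> t \<Longrightarrow> Q t S \<Longrightarrow> Q s S"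
    and loc: "\<And>s S S'. S \<inter> {..<s} = S' \<inter> {..<s} \<Longrightarrow> Q s S \<Longrightarrow> Q s S'"
  shows "\<exists>S. \<forall>s. Q s S"
proof -
  \<comment> \<open>\<open>E n T\<close> says that the initial segment \<open>T\<close> of length
    \<open>n\<close> extends to a solution at every stage: these are the extendible nodes of the
    tree.\<close>
  define E where "E n T \<longleftrightarrow> (\<forall>s. \<exists>S. S \<inter> {..<n} = T \<and> Q s S)" for n T
  have "\<exists>T'. E (Suc n) T' \<and> T' \<inter> {..<n} = T" if T: "E n T" for n T
  proof -
    have Tn: "T \<subseteq> {..<n}" using T unfolding E_def by blast
    have "E (Suc n) T \<or> E (Suc n) (insert n T)"
    proof (rule ccontr)
      assume "\<not> ?thesis"
      then obtain s t where s: "\<And>S. S \<inter> {..<Suc n} = T \<Longrightarrow> \<not> Q s S"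
        and t: "\<And>S. S \<inter> {..<Suc n} = insert n T \<Longrightarrow> \<not> Q t S" unfolding E_def by metis
      \<comment> \<open>If the two successors of \<open>T\<close> die at stages \<open>s\<close> and
        \<open>t\<close>, a solution at the later stage contradicts one of them, as it also solves
        both earlier stages.\<close>
      obtain S where S: "S \<inter> {..<n} = T" "Q (max s t) S" using T unfolding E_def by metis
      then have Q: "Q s S" "Q t S" using anti max.cobounded1 max.cobounded2 by blast+
      have "S \<inter> {..<Suc n} = (if n \<in> S then insert n T else T)"
        using S(1) by (auto simp: lessThan_Suc)
      then show False using Q s t by (cases "n \<in> S") auto
    qed
    moreover have "insert n T \<inter> {..<n} = T" "T \<inter> {..<n} = T" using Tn by auto
    ultimately show ?thesis by blast
  qed
  moreover have "E 0 {}" using ne unfolding E_def by simp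
  ultimately obtain T where T: "\<And>n. E n (T n)" "\<And>n. T (Suc n) \<inter> {..<n} = T n"
    using dependent_nat_choice[of E "\<lambda>n T T'. T' \<inter> {..<n} = T"] by metis
  have sub: "T n \<subseteq> {..<n}" for n using T(1)[of n] unfolding E_def by blast
  have coh: "T m \<inter> {..<n} = T n" if "n \<le> m" for n m
    using that
  proof (induction m rule: dec_induct)
    case base
    then show ?case using sub by blast
  next
    case (step m)
    have "T (Suc m) \<inter> {..<n} = (T (Suc m) \<inter> {..<m}) \<inter> {..<n}" using step.hyps by auto
    then show ?case using T(2) step.IH by simp
  qed
  define S where "S = {x. x \<in> T (Suc x)}"
  have "S \<inter> {..<n} = T n" for n
  proof -
    have "x \<in> T (Suc x) \<longleftrightarrow> x \<in> T n" if "x < n" for x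
      using coh[of "Suc x" n] that by (metis IntE IntI Suc_leI lessI lessThan_iff)
    then show ?thesis using sub[of n] unfolding S_def by auto
  qed
  moreover have "\<exists>S'. S' \<inter> {..<n} = T n \<and> Q n S'" for n using T(1) unfolding E_def by blast
  ultimately have "Q n S" for n using loc by metis
  then show ?thesis by blast
qed

text \<open>A query \<open>x < s\<close> to a join asks a component about \<open>x div 2\<close>,
  which is still below \<open>s\<close>.\<close>

lemma ev_join_cong:
  assumes "S \<inter> {..<s} = S' \<inter> {..<s}"
  shows "ev (S \<oplus> B) s e xs = ev (S' \<oplus> B) s e xs"
proof (rule ev_cong)
  fix x assume "x < s"
  then have "x div 2 \<in> S \<longleftrightarrow> x div 2 \<in> S'"
    using assms by (metis IntE IntI div_le_dividend le_less_trans lessThan_iff)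
  then show "x \<in> S \<oplus> B \<longleftrightarrow> x \<in> S' \<oplus> B" by (simp add: turing_join_iff)
qed

lemma set_encode_less: "T \<subseteq> {..<s} \<Longrightarrow> set_encode T < 2 ^ s"
proof -
  assume that: "T \<subseteq> {..<s}"
  have "sum ((^) 2) T \<le> sum ((^) (2::nat)) {..<s}" using that by (intro sum_mono2) auto
  moreover have "sum ((^) (2::nat)) {..<s} < 2 ^ s" by (induction s) auto
  ultimately show ?thesis unfolding set_encode_def by simp
qed

text \<open>Quantifying over all sets preserves semidecidability. By compactness, if the code halts
  for all \<open>S\<close>, one stage \<open>s\<close> works for all of them; at that stage only
  \<open>S\<close> below \<open>s\<close> matters, which leaves the finitely many sets coded by
  numbers below \<open>2 ^ s\<close>.\<close>

lemma semidecidable_on_All: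
  assumes "semidecidable_on (\<lambda>S. S \<oplus> B) k R"
  shows "\<exists>P. decidable_on (\<lambda>_::unit. B) (Suc k) (\<lambda>_ ys. P (hd ys) (tl ys)) \<and>
    (\<forall>xs. length xs = k \<longrightarrow> ((\<forall>S. R S xs) \<longleftrightarrow> (\<exists>s. P s xs)))"
proof -
  obtain e where e: "\<forall>S xs. length xs = k \<longrightarrow> (R S xs \<longleftrightarrow> (\<exists>y. eval (S \<oplus> B) e xs y))"
    using assms unfolding semidecidable_on_def ..
  let ?P = "\<lambda>s xs. \<forall>p<2 ^ s. ev (set_decode p \<oplus> B) s e xs \<noteq> 0"
  let ?gs = "map (\<lambda>j (i::unit) ys. tl (tl ys) ! j) [0..<k]"
  have "computable_on (\<lambda>_::unit. B) (Suc (Suc k)) (\<lambda>i ys. ev (set_decode (hd ys) \<oplus> B) (hd (tl ys)) e (map (\<lambda>g. g i ys) ?gs))"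
    by (rule computable_on_ev[of "\<lambda>_. B" "\<lambda>_ p. set_decode p \<oplus> B"])
      (auto intro!: decidable_on_join decidable_on_set_decode decidable_on_mem[of "\<lambda>_. B" "\<lambda>_. B"] reducible_on_refl
        computable_on_div2 computable_on_hd computable_on_tl computable_on_nth)
  then have "computable_on (\<lambda>_::unit. B) (Suc (Suc k)) (\<lambda>i ys. ev (set_decode (hd ys) \<oplus> B) (hd (tl ys)) e (tl (tl ys)))"
    by (rule computable_on_cong) (simp add: comp_def map_nth_upt)
  then have "decidable_on (\<lambda>_::unit. B) (Suc k) (\<lambda>_ ys. ?P (hd ys) (tl ys))"
    by (intro decidable_on_Ball_less decidable_on_not decidable_on_eq computable_on_const computable_on_pow2 computable_on_hd)
  moreover have "(\<forall>S. R S xs) \<longleftrightarrow> (\<exists>s. ?P s xs)" if k: "length xs = k" for xs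
  proof
    assume "\<forall>S. R S xs"
    then have "\<forall>S. \<exists>s. ev (S \<oplus> B) s e xs \<noteq> 0" using e k halts_iff_ev by simp
    then have "\<not> (\<exists>S. \<forall>s. ev (S \<oplus> B) s e xs = 0)" by simp
    then have "\<not> (\<forall>s. \<exists>S. ev (S \<oplus> B) s e xs = 0)"
    proof (rule contrapos_nn)
      assume "\<forall>s. \<exists>S. ev (S \<oplus> B) s e xs = 0"
      moreover have "ev (S \<oplus> B) s e xs = 0" if "s \<le> t" "ev (S \<oplus> B) t e xs = 0" for s t S
        using that ev_mono[of s t "S \<oplus> B" e xs] by (metis nat.simps(3) not0_implies_Suc)
      ultimately show "\<exists>S. \<forall>s. ev (S \<oplus> B) s e xs = 0"
        using ev_join_cong by (intro cantor_compact) metis+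
    qed
    then obtain s where "\<forall>S. ev (S \<oplus> B) s e xs \<noteq> 0" by auto
    then show "\<exists>s. ?P s xs" by blast
  next
    assume "\<exists>s. ?P s xs"
    then obtain s where s: "?P s xs" ..
    show "\<forall>S. R S xs"
    proof
      fix S
      let ?p = "set_encode (S \<inter> {..<s})"
      have "set_decode ?p = S \<inter> {..<s}" by simp
      moreover have "?p < 2 ^ s" by (rule set_encode_less) blast
      ultimately have "ev ((S \<inter> {..<s}) \<oplus> B) s e xs \<noteq> 0" using s by metis
      moreover have "ev ((S \<inter> {..<s}) \<oplus> B) s e xs = ev (S \<oplus> B) s e xs" by (rule ev_join_cong) blast
      ultimately show "R S xs" using e k halts_iff_ev by metis
    qed
  qed
  ultimately show ?thesis by (intro exI[of _ ?P] conjI) simp_all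
qed

section \<open>Cone avoidance on Cantor space\<close>

text \<open>If both alternatives fail, then \<open>R\<close> holds for all \<open>S\<close> at the
  correct value and at no other. By \<open>semidecidable_on_All\<close> this can be recognised from
  \<open>B\<close>, so \<open>A\<close> would be computable from \<open>B\<close>.\<close>

lemma cone_avoiding_dichotomy:
  assumes A: "\<not> A \<le>\<^sub>T B" and R: "semidecidable_on (\<lambda>S. S \<oplus> B) 2 R"
  shows "(\<exists>n. \<forall>S. R S [n, of_bool (n \<notin> A)]) \<or> (\<exists>n S. \<not> R S [n, of_bool (n \<in> A)])"
proof (rule ccontr)
  assume "\<not> ?thesis"
  then have yes: "R S [n, of_bool (n \<in> A)]" and no: "\<exists>S. \<not> R S [n, of_bool (n \<notin> A)]" for n S
    by blast+
  have *: "(\<forall>S. R S [n, of_bool b]) \<longleftrightarrow> (b \<longleftrightarrow> n \<in> A)" for n b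
  proof (cases "b \<longleftrightarrow> n \<in> A")
    case True
    then show ?thesis using yes by blast
  next
    case False
    then have "b = (n \<notin> A)" by blast
    then show ?thesis using no[of n] False by blast
  qed
  obtain P where P: "decidable_on (\<lambda>_::unit. B) (Suc 2) (\<lambda>_ ys. P (hd ys) (tl ys)) \<and>
    (\<forall>xs. length xs = 2 \<longrightarrow> ((\<forall>S. R S xs) \<longleftrightarrow> (\<exists>s. P s xs)))"
    using semidecidable_on_All[OF R] ..
  have P': "(\<exists>s. P s [n, of_bool b]) \<longleftrightarrow> (b \<longleftrightarrow> n \<in> A)" for n b
    using P[THEN conjunct2, rule_format, of "[n, of_bool b]"] * by simp
  have dec: "decidable_on (\<lambda>_::unit. B) k (\<lambda>i xs. P (s i xs) [a i xs, b])"
    if "computable_on (\<lambda>_::unit. B) k s" "computable_on (\<lambda>_::unit. B) k a" for k s a b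
  proof -
    have "computable_on (\<lambda>_::unit. B) k (\<lambda>i xs. (\<lambda>i ys. of_bool (P (hd ys) (tl ys))) i (map (\<lambda>g. g i xs) [s, a, \<lambda>_ _. b]))"
      using P[THEN conjunct1] that unfolding decidable_on_def
      by (intro computable_on_comp) (auto intro: computable_on_const simp: eval_nat_numeral)
    then show ?thesis unfolding decidable_on_def by simp
  qed
  \<comment> \<open>The two searches run in parallel. Exactly one of them can succeed, namely that
    for the correct value, so the first success decides membership in \<open>A\<close>.\<close>
  let ?s = "\<lambda>x. LEAST s. P s [x, of_bool True] \<or> P s [x, of_bool False]"
  have "decidable_on (\<lambda>_::unit. B) (Suc 0) (\<lambda>i xs. P (?s (hd xs)) [hd xs, of_bool True])"
    by (intro dec computable_on_Least decidable_on_disj computable_on_hd computable_on_tl) (metis P')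
  moreover have "P (?s x) [x, of_bool True] \<longleftrightarrow> x \<in> A" for x
  proof -
    have "\<exists>s. P s [x, of_bool True] \<or> P s [x, of_bool False]" using P'[of x] by metis
    then have "P (?s x) [x, of_bool True] \<or> P (?s x) [x, of_bool False]" by (rule LeastI_ex)
    then show ?thesis using P'[of x True] P'[of x False] by blast
  qed
  ultimately have "A \<le>\<^sub>T B" by (simp add: turing_reducible_iff reducible_on_iff)
  with A show False ..
qed

instance recf :: countable
  by countable_datatype

text \<open>Cone avoidance basis theorem for effectively closed classes, here given by their
  complements \<open>R\<close>. The class is shrunk once for each code \<open>c\<close>, staying
  nonempty, until no member computes \<open>A\<close> via \<open>c\<close>; compactness yields a
  member of all the classes.\<close>

lemma cone_avoiding_basis:
  assumes A: "\<not> A \<le>\<^sub>T B" and R: "semidecidable_on (\<lambda>S. S \<oplus> B) 0 (\<lambda>S _. R S)" and ne: "\<exists>S. \<not> R S"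
  shows "\<exists>S. \<not> R S \<and> \<not> A \<le>\<^sub>T S \<oplus> B"
proof -
  let ?sd = "\<lambda>R. semidecidable_on (\<lambda>S. S \<oplus> B) 0 (\<lambda>S _. R S)"
  define D where "D c S \<longleftrightarrow> (\<forall>n. eval (S \<oplus> B) c [n] (of_bool (n \<in> A)))" for c S
  have step: "\<exists>R'. (?sd R' \<and> (\<exists>S. \<not> R' S)) \<and> ((\<forall>S. R S \<longrightarrow> R' S) \<and> (\<forall>S. D c S \<longrightarrow> R' S))"
    if R: "?sd R" "\<exists>S. \<not> R S" for R c
  proof -
    have 1: "semidecidable_on (\<lambda>S. S \<oplus> B) 2 (\<lambda>S xs. R S)"
      using semidecidable_on_comp[of "\<lambda>S. S \<oplus> B" "[]" "\<lambda>S _. R S" 2] R(1) by simp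
    have 2: "semidecidable_on (\<lambda>S. S \<oplus> B) 2 (\<lambda>S xs. \<exists>p::nat. True \<and> eval (S \<oplus> B) c [hd xs] (hd (tl xs)))"
      by (rule semidecidable_on_eval) (intro decidable_on_mem reducible_on_refl decidable_on_const | assumption)+
    \<comment> \<open>\<open>R2\<close> says that \<open>S\<close> has left the class or that
      \<open>c\<close> gives the stated output. The dichotomy then provides either an
      \<open>n\<close> at which \<open>c\<close> is wrong on the whole class, or a nonempty subclass
      on which \<open>c\<close> does not give the correct output at \<open>n\<close>.\<close>
    define R2 where "R2 S xs \<longleftrightarrow> R S \<or> eval (S \<oplus> B) c [hd xs] (hd (tl xs))" for S and xs :: "nat list"
    have R2: "semidecidable_on (\<lambda>S. S \<oplus> B) 2 R2"
      using semidecidable_on_disj[OF 1 2] unfolding R2_def by simp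
    consider n where "\<forall>S. R2 S [n, of_bool (n \<notin> A)]" | n S where "\<not> R2 S [n, of_bool (n \<in> A)]"
      using cone_avoiding_dichotomy[OF A R2] by blast
    then show ?thesis
    proof cases
      case 1
      have "R S" if "D c S" for S
      proof (rule ccontr)
        assume "\<not> R S"
        then have "eval (S \<oplus> B) c [n] (of_bool (n \<notin> A))" using 1 unfolding R2_def list.sel by blast
        moreover have "eval (S \<oplus> B) c [n] (of_bool (n \<in> A))" using that unfolding D_def ..
        ultimately have "of_bool (n \<notin> A) = (of_bool (n \<in> A) :: nat)" by (rule eval_deterministic)
        then show False by (cases "n \<in> A") simp_all
      qed
      then show ?thesis using R by blast
    next
      case 2
      let ?R' = "\<lambda>S. R2 S [n, of_bool (n \<in> A)]"
      have "?sd ?R'" using R2 by (rule semidecidable_on_pair)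
      moreover have "\<exists>S. \<not> ?R' S" using 2 by blast
      moreover have "R S \<longrightarrow> ?R' S" "D c S \<longrightarrow> ?R' S" for S unfolding R2_def D_def by simp_all
      ultimately show ?thesis by (intro exI[of _ ?R'] conjI allI)
    qed
  qed
  \<comment> \<open>The clause for \<open>n = 0\<close> pins down the start of the sequence, and
    step \<open>n\<close> treats the code numbered \<open>n\<close>.\<close>
  have "\<exists>R'. \<forall>n. (?sd (R' n) \<and> (\<exists>S. \<not> R' n S) \<and> (n = 0 \<longrightarrow> R' n = R)) \<and>
      ((\<forall>S. R' n S \<longrightarrow> R' (Suc n) S) \<and> (\<forall>S. D (from_nat n) S \<longrightarrow> R' (Suc n) S))"
    using R ne step by (intro dependent_nat_choice) (blast, metis nat.simps(3))
  then obtain R' where R': "\<And>n. ?sd (R' n)" "\<And>n. \<exists>S. \<not> R' n S" "R' 0 = R" "\<And>n S. R' n S \<Longrightarrow> R' (Suc n) S"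
    "\<And>n S. D (from_nat n) S \<Longrightarrow> R' (Suc n) S" by metis
  have "\<forall>n. \<exists>e. \<forall>S. R' n S \<longleftrightarrow> (\<exists>y. eval (S \<oplus> B) e [] y)"
    using R'(1) unfolding semidecidable_on_def by simp
  from choice[OF this] obtain e where "\<forall>n S. R' n S \<longleftrightarrow> (\<exists>y. eval (S \<oplus> B) (e n) [] y)" ..
  then have e: "R' n S \<longleftrightarrow> (\<exists>s. ev (S \<oplus> B) s (e n) [] \<noteq> 0)" for n S using halts_iff_ev by simp
  have mono: "R' n S" if "m \<le> n" "R' m S" for m n S
    using that by (induction n rule: dec_induct) (auto intro: R'(4))
  have z: "ev (S \<oplus> B) s c [] = 0" if "s \<le> t" "ev (S \<oplus> B) t c [] = 0" for s t S c
    using that ev_mono[of s t "S \<oplus> B" c "[]"] by (metis nat.simps(3) not0_implies_Suc)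
  \<comment> \<open>Stage \<open>s\<close> tests only the first classes, up to number
    \<open>s\<close>; the condition thus remains local, and a set passing every stage belongs to
    every class.\<close>
  have "\<exists>S. \<forall>s. \<forall>n\<le>s. ev (S \<oplus> B) s (e n) [] = 0"
  proof (rule cantor_compact)
    show "\<exists>S. \<forall>n\<le>s. ev (S \<oplus> B) s (e n) [] = 0" for s
    proof -
      obtain S where "\<not> R' s S" using R'(2) by blast
      then have "\<not> R' n S" if "n \<le> s" for n using mono that by blast
      then show ?thesis using e by blast
    qed
    show "\<forall>n\<le>s. ev (S' \<oplus> B) s (e n) [] = 0"
      if "S \<inter> {..<s} = S' \<inter> {..<s}" "\<forall>n\<le>s. ev (S \<oplus> B) s (e n) [] = 0" for s S S'
      using that ev_join_cong by metis
  qed (use z in \<open>meson order_trans\<close>)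
  then obtain S where S: "ev (S \<oplus> B) s (e n) [] = 0" if "n \<le> s" for s n by blast
  have nR: "\<not> R' n S" for n
  proof -
    have "ev (S \<oplus> B) s (e n) [] = 0" for s using S[of n "max n s"] z[of s "max n s"] by simp
    then show ?thesis using e by simp
  qed
  have "\<not> D c S" for c using nR R'(5)[of "to_nat c" S] by auto
  then have "\<not> A \<le>\<^sub>T S \<oplus> B" unfolding turing_reducible_def computable_in_def D_def by blast
  then show ?thesis using nR[of 0] R'(3) by auto
qed

text \<open>Once \<open>n\<close> is fixed, the sets violating \<open>R\<close> form an effectively
  closed class, so the basis theorem improves the counterexample to one that does not help to
  compute \<open>A\<close>.\<close>

lemma cone_avoiding_dichotomy_basis:
  assumes A: "\<not> A \<le>\<^sub>T B" and R: "semidecidable_on (\<lambda>S. S \<oplus> B) 2 R"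
  obtains n where "\<And>S. R S [n, of_bool (n \<notin> A)]"
  | n S where "\<not> R S [n, of_bool (n \<in> A)]" "\<not> A \<le>\<^sub>T S \<oplus> B"
proof -
  consider n where "\<forall>S. R S [n, of_bool (n \<notin> A)]" | n S where "\<not> R S [n, of_bool (n \<in> A)]"
    using cone_avoiding_dichotomy[OF assms] by blast
  then show thesis
  proof cases
    case 1
    then show thesis using that(1) by blast
  next
    case 2
    have "semidecidable_on (\<lambda>S. S \<oplus> B) 0 (\<lambda>S _. R S [n, of_bool (n \<in> A)])"
      using R by (rule semidecidable_on_pair)
    from cone_avoiding_basis[OF A this] 2 show thesis using that(2) by blast
  qed
qed

section \<open>Mathias forcing\<close>

text \<open>The Mathias condition \<open>(F, X)\<close> forces that the functional \<open>c\<close>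
  fails to compute \<open>A\<close> from \<open>G \<oplus> B\<close>.\<close>

definition blocked :: "nat set \<Rightarrow> nat set \<Rightarrow> recf \<Rightarrow> nat set \<Rightarrow> nat set \<Rightarrow> bool" where
  "blocked A B c F X \<longleftrightarrow> (\<forall>G. F \<subseteq> G \<longrightarrow> G \<subseteq> F \<union> X \<longrightarrow> \<not> (\<forall>n. eval (G \<oplus> B) c [n] (of_bool (n \<in> A))))"

text \<open>The number of steps of a convergent computation bounds the part of \<open>G\<close> that
  it uses.\<close>

lemma eval_join_use:
  assumes "eval (G \<oplus> B) c xs y"
  obtains u where "\<And>G'. G' \<inter> {..<u} = G \<inter> {..<u} \<Longrightarrow> eval (G' \<oplus> B) c xs y"
proof -
  obtain s where s: "ev (G \<oplus> B) s c xs = Suc y" using assms eval_iff_ev by blast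
  have "eval (G' \<oplus> B) c xs y" if "G' \<inter> {..<s} = G \<inter> {..<s}" for G'
    using s ev_join_cong[OF that] eval_iff_ev by metis
  then show thesis by (rule that)
qed

text \<open>A wrong output persists as long as nothing below its use is added to the stem.\<close>

lemma blocked_if_wrong:
  assumes "eval (F \<oplus> B) c [n] (of_bool (n \<notin> A))"
  shows "\<exists>u. \<forall>X. X \<subseteq> {u..} \<longrightarrow> blocked A B c F X"
proof -
  obtain u where u: "\<And>G. G \<inter> {..<u} = F \<inter> {..<u} \<Longrightarrow> eval (G \<oplus> B) c [n] (of_bool (n \<notin> A))"
    using eval_join_use[OF assms] by blast
  have "\<not> (\<forall>n. eval (G \<oplus> B) c [n] (of_bool (n \<in> A)))"
    if "X \<subseteq> {u..}" "F \<subseteq> G" "G \<subseteq> F \<union> X" for X G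
  proof
    assume "\<forall>n. eval (G \<oplus> B) c [n] (of_bool (n \<in> A))"
    then have "eval (G \<oplus> B) c [n] (of_bool (n \<in> A))" ..
    moreover have "eval (G \<oplus> B) c [n] (of_bool (n \<notin> A))" using that by (intro u) fastforce
    ultimately have "of_bool (n \<in> A) = (of_bool (n \<notin> A) :: nat)" by (rule eval_deterministic)
    then show False by (cases "n \<in> A") simp_all
  qed
  then show ?thesis unfolding blocked_def by blast
qed

text \<open>If some \<open>G\<close> gave the correct output at \<open>n\<close>, its elements below
  the use, added to \<open>F\<close>, would be a finite extension giving the same output.\<close>

lemma blocked_if_never_right:
  assumes "\<And>E. finite E \<Longrightarrow> E \<subseteq> X \<Longrightarrow> \<not> eval ((F \<union> E) \<oplus> B) c [n] (of_bool (n \<in> A))"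
  shows "blocked A B c F X"
  unfolding blocked_def
proof (intro allI impI notI)
  fix G assume G: "F \<subseteq> G" "G \<subseteq> F \<union> X" "\<forall>n. eval (G \<oplus> B) c [n] (of_bool (n \<in> A))"
  then have "eval (G \<oplus> B) c [n] (of_bool (n \<in> A))" by blast
  from eval_join_use[OF this]
  obtain u where u: "\<And>G'. G' \<inter> {..<u} = G \<inter> {..<u} \<Longrightarrow> eval (G' \<oplus> B) c [n] (of_bool (n \<in> A))" by blast
  let ?E = "(G - F) \<inter> {..<u}"
  have "eval ((F \<union> ?E) \<oplus> B) c [n] (of_bool (n \<in> A))" using G(1) by (intro u) blast
  moreover have "finite ?E" "?E \<subseteq> X" using G(2) by auto
  ultimately show False using assms by blast
qed

text \<open>The forcing construction for an arbitrary class \<open>P\<close> of conditions.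
  \<open>ext\<close> makes the union of the stems infinite and \<open>block\<close> treats every
  code in turn. The last clause transfers properties of finite subsets, such as being
  non-decreasing, from the stems to \<open>G\<close>.\<close>

lemma generic_set_exists:
  fixes P :: "nat set \<Rightarrow> nat set \<Rightarrow> bool"
  assumes base: "P F0 X0"
    and ext: "\<And>F X. P F X \<Longrightarrow> \<exists>F' X'. P F' X' \<and> F \<subset> F' \<and> F' \<subseteq> F \<union> X \<and> X' \<subseteq> X"
    and block: "\<And>F X c. P F X \<Longrightarrow> \<exists>F' X'. P F' X' \<and> F \<subseteq> F' \<and> F' \<subseteq> F \<union> X \<and> X' \<subseteq> X \<and> blocked A B c F' X'"
  shows "\<exists>G. infinite G \<and> \<not> A \<le>\<^sub>T G \<oplus> B \<and> G \<subseteq> F0 \<union> X0 \<and>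
    (\<forall>E. finite E \<longrightarrow> E \<subseteq> G \<longrightarrow> (\<exists>F X. P F X \<and> E \<subseteq> F))"
proof -
  let ?Q = "\<lambda>n p p'. fst p \<subset> fst p' \<and> fst p' \<subseteq> fst p \<union> snd p \<and> snd p' \<subseteq> snd p
      \<and> blocked A B (from_nat n) (fst p') (snd p')"
  have step: "\<exists>p'. case_prod P p' \<and> ?Q n p p'" if "case_prod P p" for p and n :: nat
  proof -
    obtain F X where p: "p = (F, X)" by (cases p)
    then have "P F X" using that by simp
    obtain F1 X1 where 1: "P F1 X1" "F \<subset> F1" "F1 \<subseteq> F \<union> X" "X1 \<subseteq> X"
      using ext[OF \<open>P F X\<close>] by blast
    obtain F2 X2 where "P F2 X2" "F1 \<subseteq> F2" "F2 \<subseteq> F1 \<union> X1" "X2 \<subseteq> X1" "blocked A B (from_nat n) F2 X2"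
      using block[OF 1(1), of "from_nat n"] by blast
    then show ?thesis using 1 p by (intro exI[of _ "(F2, X2)"]) auto
  qed
  have "\<exists>q. \<forall>n. (case_prod P (q n) \<and> (n = 0 \<longrightarrow> q n = (F0, X0))) \<and> ?Q n (q n) (q (Suc n))"
  proof (rule dependent_nat_choice)
    show "\<exists>p. case_prod P p \<and> (0 = 0 \<longrightarrow> p = (F0, X0))" using base by simp
    show "\<exists>p'. (case_prod P p' \<and> (Suc n = 0 \<longrightarrow> p' = (F0, X0))) \<and> ?Q n p p'"
      if "case_prod P p \<and> (n = 0 \<longrightarrow> p = (F0, X0))" for p n
    proof -
      from step[OF conjunct1[OF that]] obtain p' where "case_prod P p' \<and> ?Q n p p'" ..
      then show ?thesis by (intro exI[of _ p']) simp
    qed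
  qed
  then obtain q where q: "\<forall>n. (case_prod P (q n) \<and> (n = 0 \<longrightarrow> q n = (F0, X0))) \<and> ?Q n (q n) (q (Suc n))" ..
  define F X where "F n = fst (q n)" and "X n = snd (q n)" for n
  have P: "P (F n) (X n)" for n using spec[OF q, of n] unfolding F_def X_def by (simp add: case_prod_beta)
  have F: "F n \<subset> F (Suc n)" "F (Suc n) \<subseteq> F n \<union> X n" "X (Suc n) \<subseteq> X n"
    "blocked A B (from_nat n) (F (Suc n)) (X (Suc n))" for n
    using spec[OF q, THEN conjunct2, of n] unfolding F_def X_def by simp_all
  have F_mono: "F m \<subseteq> F n" if "m \<le> n" for m n
    using that by (rule lift_Suc_mono_le[of F, rotated]) (use F(1) in blast)
  have "F m \<subseteq> F n \<union> X n \<and> X m \<subseteq> X n" if "n \<le> m" for m n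
    using that by (induction m rule: dec_induct) (use F(2,3) in blast)+
  \<comment> \<open>Every stem lies between the constraints of every condition, earlier or later.
    Hence \<open>G\<close> is among the sets over which each \<open>blocked\<close> statement
    quantifies.\<close>
  then have FX: "F m \<subseteq> F n \<union> X n" for m n
    using F_mono[of m n] by (cases "n \<le> m") auto
  define G where "G = (\<Union>n. F n)"
  have cover: "\<exists>n. E \<subseteq> F n" if "finite E" "E \<subseteq> G" for E
    using that
  proof (induction E rule: finite_induct)
    case (insert x E)
    then obtain m n where "E \<subseteq> F n" "x \<in> F m" unfolding G_def by blast
    then have "insert x E \<subseteq> F (max m n)" using F_mono[of m "max m n"] F_mono[of n "max m n"] by auto
    then show ?case ..
  qed simp
  show ?thesis
  proof (rule exI[of _ G], intro conjI allI impI)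
    show "infinite G"
    proof
      assume "finite G"
      then obtain n where "G \<subseteq> F n" using cover by blast
      then show False using F(1)[of n] unfolding G_def by blast
    qed
    show "\<not> A \<le>\<^sub>T G \<oplus> B"
    proof
      assume "A \<le>\<^sub>T G \<oplus> B"
      then obtain c where c: "\<forall>n. eval (G \<oplus> B) c [n] (of_bool (n \<in> A))"
        unfolding turing_reducible_def computable_in_def ..
      have "F (Suc (to_nat c)) \<subseteq> G" "G \<subseteq> F (Suc (to_nat c)) \<union> X (Suc (to_nat c))"
        using FX unfolding G_def by auto
      then show False using F(4)[of "to_nat c"] c unfolding blocked_def from_nat_to_nat by blast
    qed
    show "G \<subseteq> F0 \<union> X0" using FX[of _ 0] spec[OF q, of 0] unfolding G_def F_def X_def by auto
    show "\<exists>F X. P F X \<and> E \<subseteq> F" if "finite E" "E \<subseteq> G" for E using cover[OF that] P by blast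
  qed
qed

section \<open>Closure properties used for reservoirs\<close>

lemma turing_reducibleI: "decidable_on (\<lambda>_::unit. Z) (Suc 0) (\<lambda>_ xs. hd xs \<in> M) \<Longrightarrow> M \<le>\<^sub>T Z"
  by (simp add: turing_reducible_iff reducible_on_iff)

lemma decidable_on_mem_const:
  "M \<le>\<^sub>T Z \<Longrightarrow> computable_on (\<lambda>_. Z) k a \<Longrightarrow> decidable_on (\<lambda>_. Z) k (\<lambda>i xs. a i xs \<in> M)"
  using decidable_on_mem[OF reducible_on_const] .

lemma turing_reducible_Int: "M \<le>\<^sub>T Z \<Longrightarrow> N \<le>\<^sub>T Z \<Longrightarrow> M \<inter> N \<le>\<^sub>T Z"
  by (rule turing_reducibleI) (simp, intro decidable_on_conj decidable_on_mem_const computable_on_hd)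

lemma turing_reducible_Diff: "M \<le>\<^sub>T Z \<Longrightarrow> N \<le>\<^sub>T Z \<Longrightarrow> M - N \<le>\<^sub>T Z"
  by (rule turing_reducibleI) (simp, intro decidable_on_conj decidable_on_not decidable_on_mem_const computable_on_hd)

lemma turing_reducible_finite: "finite M \<Longrightarrow> M \<le>\<^sub>T Z"
  by (rule turing_reducibleI) (intro decidable_on_finite computable_on_hd)

lemma turing_reducible_joinD: "A \<oplus> B \<le>\<^sub>T C \<Longrightarrow> A \<le>\<^sub>T C" "A \<oplus> B \<le>\<^sub>T C \<Longrightarrow> B \<le>\<^sub>T C"
  by (simp_all add: turing_reducible_join_iff)

lemma not_reducible_join_mono:
  assumes "\<not> A \<le>\<^sub>T Z" "Y \<le>\<^sub>T Z" "B \<le>\<^sub>T Z"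
  shows "\<not> A \<le>\<^sub>T Y \<oplus> B"
  using assms turing_reducible_join_iff turing_reducible_trans by blast

lemma not_reducible_Diff_finite:
  assumes "\<not> A \<le>\<^sub>T Y \<oplus> B" "finite D"
  shows "\<not> A \<le>\<^sub>T (Y - D) \<oplus> B"
  by (rule not_reducible_join_mono[OF assms(1) turing_reducible_Diff[OF _ turing_reducible_finite[OF assms(2)]]])
    (rule turing_reducible_joinD[OF turing_reducible_refl])+

text \<open>A quantifier over the members of a coded set can thereby be bounded by the code itself,
  which keeps it decidable.\<close>

lemma mem_set_decode_less: "x \<in> set_decode p \<Longrightarrow> x < p"
proof -
  assume "x \<in> set_decode p"
  then have "2 ^ x \<le> p" unfolding set_decode_def
    by (metis div_less even_zero linorder_not_le mem_Collect_eq)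
  then show ?thesis using less_exp[of x] by linarith
qed

lemma decidable_on_set_decode_subset:
  assumes "reducible_on \<Phi> V" "computable_on \<Phi> k p"
  shows "decidable_on \<Phi> k (\<lambda>i xs. set_decode (p i xs) \<subseteq> V i)"
proof -
  have "decidable_on \<Phi> k (\<lambda>i xs. \<forall>x<p i xs. x \<in> set_decode (p i xs) \<longrightarrow> x \<in> V i)"
    by (intro decidable_on_Ball_less decidable_on_imp decidable_on_set_decode decidable_on_mem assms
      computable_on_hd computable_on_tl)
  then show ?thesis by (rule decidable_on_cong) (auto dest: mem_set_decode_less)
qed

lemma semidecidable_on_extension:
  assumes B: "reducible_on \<Phi> (\<lambda>_. B)" and F: "finite F"
    and Q: "decidable_on \<Phi> (Suc 0) (\<lambda>i xs. Q i (hd xs))"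
  shows "semidecidable_on \<Phi> 2 (\<lambda>i xs. \<exists>p. Q i p \<and> eval ((F \<union> set_decode p) \<oplus> B) c [hd xs] (hd (tl xs)))"
proof (rule semidecidable_on_eval[OF _ Q])
  fix k a p assume "computable_on \<Phi> k a" "computable_on \<Phi> k p"
  then show "decidable_on \<Phi> k (\<lambda>i xs. a i xs \<in> (F \<union> set_decode (p i xs)) \<oplus> B)"
    unfolding Un_iff
    by (intro decidable_on_join decidable_on_mem[OF B])
      (simp_all, intro decidable_on_disj decidable_on_finite[OF F] decidable_on_set_decode computable_on_div2
       | intro computable_on_div2)+
qed

section \<open>Strong cone avoidance for two colours\<close>

text \<open>
  Two nested one-sided forcings replace the usual disjunctive requirements: if \<open>(F, Y)\<close> has no
  extension inside \<open>- T\<close> that blocks \<open>c\<close>, then \<open>F\<close> and \<open>c\<close> stay fixed while a cone-avoiding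
  subset of \<open>T\<close> is built from \<open>Y\<close>, because any failure on that side would give such an extension.
\<close>

lemma cone_avoiding_homogeneous:
  assumes X: "infinite X" "\<not> A \<le>\<^sub>T X \<oplus> B"
  shows "\<exists>G\<subseteq>X. infinite G \<and> (G \<subseteq> T \<or> G \<inter> T = {}) \<and> \<not> A \<le>\<^sub>T G \<oplus> B"
proof (rule ccontr)
  assume "\<not> ?thesis"
  then have nohom: "A \<le>\<^sub>T G \<oplus> B" if "G \<subseteq> X" "infinite G" "G \<subseteq> T' \<or> G \<inter> T' = {}" "T' = T \<or> T' = - T" for G T'
    using that by blast
  \<comment> \<open>Only the stem has to lie in the colour \<open>T'\<close>; the reservoir is
    merely confined to \<open>W\<close> and may contain both colours.\<close>
  define P where "P W T' F Y \<longleftrightarrow> finite F \<and> F \<subseteq> W \<inter> T' \<and> Y \<subseteq> W \<and> infinite Y \<and> \<not> A \<le>\<^sub>T Y \<oplus> B" for W T' F Y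
  have ext: "\<exists>F' Y'. P W T' F' Y' \<and> F \<subset> F' \<and> F' \<subseteq> F \<union> Y \<and> Y' \<subseteq> Y"
    if P: "P W T' F Y" and W: "W \<subseteq> X" and T': "T' = T \<or> T' = - T" for W T' F Y
  proof -
    \<comment> \<open>A reservoir without new points of colour \<open>T'\<close> would be
      homogeneous for the other colour, and removing the finite \<open>F\<close> does not affect
      cone avoidance; this contradicts \<open>nohom\<close>.\<close>
    have "\<not> (Y - F) \<inter> T' = {}"
    proof
      assume *: "(Y - F) \<inter> T' = {}"
      have "A \<le>\<^sub>T (Y - F) \<oplus> B" using P W by (intro nohom[OF _ _ _ T'] disjI2 *) (auto simp: P_def)
      moreover have "\<not> A \<le>\<^sub>T (Y - F) \<oplus> B" using P unfolding P_def by (intro not_reducible_Diff_finite) auto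
      ultimately show False by blast
    qed
    then obtain x where "x \<in> Y" "x \<notin> F" "x \<in> T'" by blast
    then show ?thesis using P unfolding P_def by (intro exI[of _ "insert x F"] exI[of _ Y]) auto
  qed
  have block: "\<exists>F' Y'. P X (- T) F' Y' \<and> F \<subseteq> F' \<and> F' \<subseteq> F \<union> Y \<and> Y' \<subseteq> Y \<and> blocked A B c F' Y'"
    if P0: "P X (- T) F Y" for F Y c
  proof (rule ccontr)
    assume noext: "\<not> ?thesis"
    have base: "P Y T {} Y" using P0 unfolding P_def by simp
    have "Y \<subseteq> X" using P0 unfolding P_def by blast
    have block': "\<exists>H' Z'. P Y T H' Z' \<and> H \<subseteq> H' \<and> H' \<subseteq> H \<union> Z \<and> Z' \<subseteq> Z \<and> blocked A B d H' Z'"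
      if P1: "P Y T H Z" for H Z d
    proof -
      \<comment> \<open>The arbitrary set \<open>T\<close> is replaced by all splittings
        \<open>S\<close> of the reservoir. The question is whether the part in \<open>S\<close>
        extends \<open>F\<close> to produce the output with \<open>c\<close>, or the part outside
        \<open>S\<close> extends \<open>H\<close> to produce it with \<open>d\<close>.\<close>
      define R where "R S xs \<longleftrightarrow>
        (\<exists>p. set_decode p \<subseteq> Z \<inter> S \<and> eval ((F \<union> set_decode p) \<oplus> B) c [hd xs] (hd (tl xs))) \<or>
        (\<exists>p. set_decode p \<subseteq> Z - S \<and> eval ((H \<union> set_decode p) \<oplus> B) d [hd xs] (hd (tl xs)))" for S xs
      have fin: "finite F" "finite H" and Z: "infinite Z" "\<not> A \<le>\<^sub>T Z \<oplus> B" "Z \<subseteq> Y"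
        using P0 P1 unfolding P_def by auto
      let ?\<Phi> = "\<lambda>S. S \<oplus> (Z \<oplus> B)"
      have red: "reducible_on ?\<Phi> (\<lambda>S. S)" "reducible_on ?\<Phi> (\<lambda>_. Z)" "reducible_on ?\<Phi> (\<lambda>_. B)"
        using reducible_on_left[of "\<lambda>S. S" "\<lambda>_. Z \<oplus> B"]
          reducible_on_joinD[OF reducible_on_right[of "\<lambda>S. S" "\<lambda>_. Z \<oplus> B"]] by auto
      have V: "reducible_on ?\<Phi> (\<lambda>S. Z \<inter> S)" "reducible_on ?\<Phi> (\<lambda>S. Z - S)"
        unfolding reducible_on_iff One_nat_def Int_iff Diff_iff
        by (intro decidable_on_conj decidable_on_not decidable_on_mem red computable_on_hd)+
      have "semidecidable_on ?\<Phi> 2 R" unfolding R_def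
        by (intro semidecidable_on_disj semidecidable_on_extension red fin decidable_on_set_decode_subset V
          computable_on_hd)
      with Z(2) show ?thesis
      proof (cases rule: cone_avoiding_dichotomy_basis)
        case (1 n)
        \<comment> \<open>For the true splitting the extension found respects the colours: points
          outside \<open>T\<close> go to \<open>F\<close>, points of \<open>T\<close> go to
          \<open>H\<close>.\<close>
        from 1[of "- T"] consider
          p where "set_decode p \<subseteq> Z \<inter> - T" "eval ((F \<union> set_decode p) \<oplus> B) c [n] (of_bool (n \<notin> A))"
          | p where "set_decode p \<subseteq> Z - - T" "eval ((H \<union> set_decode p) \<oplus> B) d [n] (of_bool (n \<notin> A))"
          unfolding R_def list.sel by blast
        then show ?thesis
        proof cases
          case 1
          obtain u where u: "\<And>X. X \<subseteq> {u..} \<Longrightarrow> blocked A B c (F \<union> set_decode p) X"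
            using blocked_if_wrong[OF 1(2)] by blast
          have "P X (- T) (F \<union> set_decode p) (Z - {..<u})"
            using P0 1(1) Z not_reducible_Diff_finite[OF Z(2), of "{..<u}"] unfolding P_def by auto
          moreover have "blocked A B c (F \<union> set_decode p) (Z - {..<u})" by (intro u) auto
          ultimately show ?thesis using noext Z(3) 1(1) by blast
        next
          case 2
          obtain u where u: "\<And>X. X \<subseteq> {u..} \<Longrightarrow> blocked A B d (H \<union> set_decode p) X"
            using blocked_if_wrong[OF 2(2)] by blast
          have "P Y T (H \<union> set_decode p) (Z - {..<u})"
            using P1 2(1) Z not_reducible_Diff_finite[OF Z(2), of "{..<u}"] unfolding P_def by auto
          moreover have "blocked A B d (H \<union> set_decode p) (Z - {..<u})" by (intro u) auto
          ultimately show ?thesis using 2(1) by blast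
        qed
      next
        case (2 n S)
        have c: "\<not> eval ((F \<union> E) \<oplus> B) c [n] (of_bool (n \<in> A))" if "finite E" "E \<subseteq> Z \<inter> S" for E
          using 2(1) that set_encode_inverse[of E] unfolding R_def list.sel by metis
        have d: "\<not> eval ((H \<union> E) \<oplus> B) d [n] (of_bool (n \<in> A))" if "finite E" "E \<subseteq> Z - S" for E
          using 2(1) that set_encode_inverse[of E] unfolding R_def list.sel by metis
        have le: "S \<le>\<^sub>T S \<oplus> (Z \<oplus> B)" "Z \<le>\<^sub>T S \<oplus> (Z \<oplus> B)" "B \<le>\<^sub>T S \<oplus> (Z \<oplus> B)"
          using turing_reducible_refl[of "S \<oplus> (Z \<oplus> B)"] by (auto simp: turing_reducible_join_iff)
        then have avoid: "\<not> A \<le>\<^sub>T (Z \<inter> S) \<oplus> B" "\<not> A \<le>\<^sub>T (Z - S) \<oplus> B"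
          using not_reducible_join_mono[OF 2(2) turing_reducible_Int[OF le(2,1)] le(3)]
            not_reducible_join_mono[OF 2(2) turing_reducible_Diff[OF le(2,1)] le(3)] by blast+
        \<comment> \<open>One half of \<open>Z\<close> is infinite and serves as new reservoir. The
          half in \<open>S\<close> would block \<open>c\<close>, against \<open>noext\<close>; the
          other half blocks \<open>d\<close>, as required.\<close>
        show ?thesis
        proof (cases "finite (Z \<inter> S)")
          case False
          then have "P X (- T) F (Z \<inter> S)" using P0 Z(3) avoid unfolding P_def by auto
          moreover have "blocked A B c F (Z \<inter> S)" using c by (rule blocked_if_never_right)
          ultimately have False using noext Z(3) by blast
          then show ?thesis ..
        next
          case True
          then have "infinite (Z - S)" using Z(1) by (metis Int_Diff_Un finite_Un)
          then have "P Y T H (Z - S)" using P1 avoid unfolding P_def by auto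
          moreover have "blocked A B d H (Z - S)" using d by (rule blocked_if_never_right)
          ultimately show ?thesis by blast
        qed
      qed
    qed
    have "\<exists>G. infinite G \<and> \<not> A \<le>\<^sub>T G \<oplus> B \<and> G \<subseteq> {} \<union> Y \<and>
      (\<forall>E. finite E \<longrightarrow> E \<subseteq> G \<longrightarrow> (\<exists>F Z. P Y T F Z \<and> E \<subseteq> F))"
      by (rule generic_set_exists[of "P Y T", OF base ext[OF _ \<open>Y \<subseteq> X\<close> disjI1[OF refl]] block'])
    then obtain G where G: "infinite G" "\<not> A \<le>\<^sub>T G \<oplus> B" "G \<subseteq> {} \<union> Y"
      "\<And>E. finite E \<Longrightarrow> E \<subseteq> G \<Longrightarrow> \<exists>F Z. P Y T F Z \<and> E \<subseteq> F" by blast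
    have "x \<in> T" if "x \<in> G" for x using G(4)[of "{x}"] that unfolding P_def by auto
    then have "A \<le>\<^sub>T G \<oplus> B" using G \<open>Y \<subseteq> X\<close> by (intro nohom[of G T]) auto
    then show False using G(2) by blast
  qed
  have base: "P X (- T) {} X" using X unfolding P_def by simp
  have "\<exists>G. infinite G \<and> \<not> A \<le>\<^sub>T G \<oplus> B \<and> G \<subseteq> {} \<union> X \<and>
    (\<forall>E. finite E \<longrightarrow> E \<subseteq> G \<longrightarrow> (\<exists>F Y. P X (- T) F Y \<and> E \<subseteq> F))"
    by (rule generic_set_exists[of "P X (- T)", OF base ext[OF _ subset_refl disjI2[OF refl]] block])
  then obtain G where G: "infinite G" "\<not> A \<le>\<^sub>T G \<oplus> B" "G \<subseteq> {} \<union> X"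
    "\<And>E. finite E \<Longrightarrow> E \<subseteq> G \<Longrightarrow> \<exists>F Y. P X (- T) F Y \<and> E \<subseteq> F" by blast
  have "x \<in> - T" if "x \<in> G" for x using G(4)[of "{x}"] that unfolding P_def by auto
  then have "A \<le>\<^sub>T G \<oplus> B" using G by (intro nohom[of G "- T"]) auto
  then show False using G(2) by blast
qed

section \<open>Non-decreasing sets\<close>

text \<open>With finite range, \<open>g\<close> is constant on an infinite part of \<open>X\<close>.
  With infinite range, the points of \<open>X\<close> at which \<open>g\<close> attains its running
  maximum form an infinite set, and membership in it needs only a bounded check.\<close>

lemma reducible_mono_on_subset:
  assumes g: "computable_in Z g" and X: "X \<le>\<^sub>T Z" "infinite X"
  shows "\<exists>Y\<subseteq>X. infinite Y \<and> mono_on Y g \<and> Y \<le>\<^sub>T Z"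
proof -
  have g': "computable_on (\<lambda>_::unit. Z) k (\<lambda>i xs. g (a i xs))" if "computable_on (\<lambda>_. Z) k a" for k a
    by (rule computable_on_comp1[of _ "\<lambda>_. g", OF g[unfolded computable_in_iff] that])
  show ?thesis
  proof (cases "finite (g ` X)")
    case True
    then obtain a where a: "infinite {x \<in> X. g x = g a}"
      using pigeonhole_infinite[OF X(2) True] by blast
    let ?Y = "{x \<in> X. g x = g a}"
    have "?Y \<le>\<^sub>T Z"
      by (rule turing_reducibleI)
        (simp, intro decidable_on_conj decidable_on_eq decidable_on_mem_const X g' computable_on_hd computable_on_const)
    moreover have "mono_on ?Y g" by (rule mono_onI) simp
    moreover have "?Y \<subseteq> X" by blast
    ultimately show ?thesis using a by (intro exI[of _ ?Y] conjI)
  next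
    case False
    let ?Y = "{x \<in> X. \<forall>y<x. y \<in> X \<longrightarrow> g y \<le> g x}"
    \<comment> \<open>The first point of \<open>X\<close> at which \<open>g\<close> exceeds
      \<open>v\<close> is a running maximum.\<close>
    have unbounded: "\<exists>x\<in>?Y. v < g x" for v
    proof -
      have "\<not> g ` X \<subseteq> {..v}" using False finite_subset[of "g ` X" "{..v}"] by auto
      then have "\<exists>x. x \<in> X \<and> v < g x" by (auto simp: not_le)
      then obtain x where x: "x \<in> X" "v < g x" and least: "\<forall>y<x. \<not> (y \<in> X \<and> v < g y)"
        unfolding exists_least_iff[of "\<lambda>x. x \<in> X \<and> v < g x"] by auto
      have "g y \<le> g x" if "y < x" "y \<in> X" for y
        using least that x(2) by (meson le_less_trans less_imp_le not_le)
      then have "x \<in> ?Y" using x(1) by simp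
      then show ?thesis using x(2) by blast
    qed
    have "infinite ?Y"
    proof
      assume "finite ?Y"
      then have "g x \<le> sum g ?Y" if "x \<in> ?Y" for x using that by (intro member_le_sum) simp_all
      then show False using unbounded[of "sum g ?Y"] by fastforce
    qed
    moreover have "mono_on ?Y g"
    proof (rule mono_onI)
      fix r s assume "r \<in> ?Y" "s \<in> ?Y" "r \<le> s"
      then show "g r \<le> g s" by (cases "r = s") simp_all
    qed
    moreover have "?Y \<le>\<^sub>T Z"
      by (rule turing_reducibleI)
        (simp, intro decidable_on_conj decidable_on_Ball_less decidable_on_imp decidable_on_le
          decidable_on_mem_const X g' computable_on_hd computable_on_tl)
    moreover have "?Y \<subseteq> X" by blast
    ultimately show ?thesis by (intro exI[of _ ?Y] conjI)
  qed
qed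

section \<open>Coding of bounded functions by sets\<close>

text \<open>
  Every set \<open>S\<close> codes a function bounded by \<open>b\<close>, and every such function has a code.  This turns
  the class of functions bounded by \<open>b\<close> into Cantor space, where compactness applies.
  The polynomial is an injective pairing of \<open>x\<close> and \<open>y\<close>.
\<close>

definition bounded_fun :: "(nat \<Rightarrow> nat) \<Rightarrow> nat set \<Rightarrow> nat \<Rightarrow> nat" where
  "bounded_fun b S x = (LEAST y. b x \<le> y \<or> (x + y) * (x + y) + x \<in> S)"

text \<open>For \<open>a \<le> u\<close> the number \<open>u * u + a\<close> lies below the next
  square, so it determines \<open>u = x + y\<close> and then \<open>a = x\<close>.\<close>

lemma square_add_inj:
  fixes x y x' y' :: nat
  assumes "(x + y) * (x + y) + x = (x' + y') * (x' + y') + x'"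
  shows "x = x' \<and> y = y'"
proof -
  have less: "u * u + a < w * w + c" if "u < w" "a \<le> u" for u a w c :: nat
  proof -
    have "Suc u * Suc u \<le> w * w" using that(1) by (intro mult_le_mono) auto
    then show ?thesis using that(2) by simp
  qed
  have "x + y = x' + y'"
    using less[of "x + y" "x' + y'" x x'] less[of "x' + y'" "x + y" x' x] assms
    by (cases "x + y" "x' + y'" rule: linorder_cases) simp_all
  then show ?thesis using assms by simp
qed

text \<open>The set is the coded graph of \<open>f\<close>. The search at \<open>x\<close> can stop
  only at \<open>f x\<close> or at some number from \<open>b x\<close> on, and
  \<open>f x \<le> b x\<close>.\<close>

lemma bounded_fun_code:
  assumes "\<And>x. f x \<le> b x"
  shows "bounded_fun b {(x + f x) * (x + f x) + x | x. True} = f"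
proof
  fix x
  have mem: "(x + y) * (x + y) + x \<in> {(x + f x) * (x + f x) + x | x. True} \<longleftrightarrow> y = f x" for y
  proof
    assume "(x + y) * (x + y) + x \<in> {(x + f x) * (x + f x) + x | x. True}"
    then obtain z where "(x + y) * (x + y) + x = (z + f z) * (z + f z) + z" by blast
    from square_add_inj[OF this] show "y = f x" by simp
  qed blast
  show "bounded_fun b {(x + f x) * (x + f x) + x | x. True} x = f x"
    unfolding bounded_fun_def mem
    by (rule Least_equality) (auto intro: le_trans[OF assms])
qed

text \<open>The cut-off at \<open>b x\<close> makes the search terminate for every set, including
  sets that do not code a graph.\<close>

lemma computable_on_bounded_fun:
  assumes "reducible_on \<Phi> (\<lambda>_. C)" "reducible_on \<Phi> V" and b: "computable_in C b" and a: "computable_on \<Phi> k a"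
  shows "computable_on \<Phi> k (\<lambda>i xs. bounded_fun b (V i) (a i xs))"
proof -
  have "computable_on (\<lambda>_. C) 1 (\<lambda>_ xs. b (hd xs))"
    using b unfolding computable_in_iff computable_on_def by simp
  then have "computable_on \<Phi> 1 (\<lambda>_ xs. b (hd xs))" by (rule computable_on_trans[OF assms(1)])
  then have b': "computable_on \<Phi> k (\<lambda>i xs. b (a i xs))" if "computable_on \<Phi> k a" for k a
    using computable_on_comp1[of \<Phi> "\<lambda>_. b"] that by blast
  show ?thesis unfolding bounded_fun_def
    by (intro computable_on_Least decidable_on_disj decidable_on_le b' decidable_on_mem assms(2)
        computable_on_add computable_on_mult computable_on_tl computable_on_hd a) auto
qed

theorem theorem2p1:
  fixes C A :: "nat set" and f :: "nat \<Rightarrow> nat"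
  assumes "\<not> A \<le>\<^sub>T C"
    and "computably_bounded_in C f"
  shows "\<exists>G :: nat set. infinite G \<and> mono_on G f \<and> \<not> A \<le>\<^sub>T (G \<oplus> C)"
proof (rule ccontr)
  assume contra: "\<not> ?thesis"
  obtain b where b: "computable_in C b" "\<And>x. f x \<le> b x"
    using assms(2) unfolding computably_bounded_in_def by blast
  define large where "large X \<longleftrightarrow> infinite X \<and> \<not> A \<le>\<^sub>T X \<oplus> C" for X
  \<comment> \<open>The lower bound on \<open>f\<close> rises by one at a time. Colour by whether
    \<open>f\<close> exceeds \<open>k\<close>: a cone-avoiding homogeneous set of the low colour
    would have \<open>f\<close> constantly \<open>k\<close> and solve the problem, against
    \<open>contra\<close>.\<close>
  have shrink: "\<exists>Y\<subseteq>X. large Y \<and> (\<forall>x\<in>Y. k \<le> f x)" if "large X" for X k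
  proof (induction k)
    case 0
    show ?case using that by auto
  next
    case (Suc k)
    then obtain Y where Y: "Y \<subseteq> X" "large Y" "\<forall>x\<in>Y. k \<le> f x" by blast
    let ?T = "{x. Suc k \<le> f x}"
    have "infinite Y" "\<not> A \<le>\<^sub>T Y \<oplus> C" using Y(2) unfolding large_def by auto
    from cone_avoiding_homogeneous[OF this, of ?T]
    obtain G where G: "G \<subseteq> Y" "large G" "G \<subseteq> ?T \<or> G \<inter> ?T = {}"
      unfolding large_def by blast
    have "\<not> G \<inter> ?T = {}"
    proof
      assume "G \<inter> ?T = {}"
      then have "\<not> Suc k \<le> f x" "k \<le> f x" if "x \<in> G" for x using that G(1) Y(3) by blast+
      then have "f x = k" if "x \<in> G" for x using that by (meson le_antisym not_less_eq_eq)
      then have "mono_on G f" by (intro mono_onI) simp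
      then show False using contra G(2) unfolding large_def by blast
    qed
    then show ?case using G Y(1) by blast
  qed
  have large_Diff: "large (X - D)" if "large X" "finite D" for X D
    using that not_reducible_Diff_finite unfolding large_def by simp
  \<comment> \<open>The clause linking \<open>F\<close> and \<open>X\<close> allows any finite part
    of \<open>X\<close> on which \<open>f\<close> is non-decreasing to be appended to the
    stem.\<close>
  define P where "P F X \<longleftrightarrow> finite F \<and> mono_on F f \<and> (\<forall>y\<in>F. \<forall>x\<in>X. y < x \<and> f y \<le> f x) \<and> large X" for F X
  have extend: "\<exists>X'\<subseteq>X. P (F \<union> E) X' \<and> X' \<subseteq> {u..}"
    if P: "P F X" and E: "finite E" "E \<subseteq> X" "mono_on E f" for F X E u
  proof -
    \<comment> \<open>Removing an initial segment places the reservoir above \<open>E\<close> and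
      above the use \<open>u\<close>; the call of \<open>shrink\<close> then lifts its values of
      \<open>f\<close> above those on \<open>E\<close>. Inserting 0 covers the case of empty
      \<open>E\<close>.\<close>
    have "large (X - ({..<u} \<union> {..Max (insert 0 E)}))" using P unfolding P_def by (intro large_Diff) auto
    from shrink[OF this] obtain Y where Y: "Y \<subseteq> X - ({..<u} \<union> {..Max (insert 0 E)})" "large Y"
      "\<forall>x\<in>Y. Max (insert 0 (f ` E)) \<le> f x" by blast
    have EY: "y < x \<and> f y \<le> f x" if "y \<in> E" "x \<in> Y" for x y
    proof
      have "y \<le> Max (insert 0 E)" using that E(1) by simp
      moreover have "Max (insert 0 E) < x" using that Y(1) by auto
      ultimately show "y < x" by simp
      have "f y \<le> Max (insert 0 (f ` E))" using that E(1) by simp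
      then show "f y \<le> f x" using Y(3) that by fastforce
    qed
    have FX: "y < x \<and> f y \<le> f x" if "y \<in> F" "x \<in> X" for x y using P that unfolding P_def by blast
    have "mono_on (F \<union> E) f"
    proof (rule mono_onI)
      fix r s assume "r \<in> F \<union> E" "s \<in> F \<union> E" "r \<le> s"
      then consider "r \<in> F" "s \<in> F" | "r \<in> E" "s \<in> E" | "r \<in> F" "s \<in> E" | "r \<in> E" "s \<in> F" by blast
      then show "f r \<le> f s"
      proof cases
        case 1
        then show ?thesis using P \<open>r \<le> s\<close> unfolding P_def by (auto dest: mono_onD)
      next
        case 2
        then show ?thesis using E(3) \<open>r \<le> s\<close> by (auto dest: mono_onD)
      next
        case 3
        then show ?thesis using FX E(2) by blast
      next
        case 4
        then have "s < r" using FX E(2) by blast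
        then show ?thesis using \<open>r \<le> s\<close> by simp
      qed
    qed
    moreover have "y < x \<and> f y \<le> f x" if "y \<in> F \<union> E" "x \<in> Y" for x y
      using that EY FX Y(1) by blast
    ultimately have "P (F \<union> E) Y" using P E(1) Y(2) unfolding P_def by simp
    moreover have "Y \<subseteq> X" "Y \<subseteq> {u..}" using Y(1) by auto
    ultimately show ?thesis by blast
  qed
  have ext: "\<exists>F' X'. P F' X' \<and> F \<subset> F' \<and> F' \<subseteq> F \<union> X \<and> X' \<subseteq> X" if P: "P F X" for F X
  proof -
    have "X \<noteq> {}" using P unfolding P_def large_def by auto
    then obtain x where x: "x \<in> X" by blast
    then have "x \<notin> F" using P unfolding P_def by blast
    moreover obtain X' where "X' \<subseteq> X" "P (F \<union> {x}) X'"
      using extend[OF P, of "{x}" 0] x by (auto simp: mono_on_def)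
    ultimately show ?thesis using x by (intro exI[of _ "F \<union> {x}"] exI[of _ X']) auto
  qed
  have block: "\<exists>F' X'. P F' X' \<and> F \<subseteq> F' \<and> F' \<subseteq> F \<union> X \<and> X' \<subseteq> X \<and> blocked A C c F' X'" if P: "P F X" for F X c
  proof -
    have fin: "finite F" and X: "infinite X" "\<not> A \<le>\<^sub>T X \<oplus> C" using P unfolding P_def large_def by auto
    let ?\<Phi> = "\<lambda>S. S \<oplus> (X \<oplus> C)"
    \<comment> \<open>The function \<open>f\<close> itself may be far from computable, so extensions
      are tested against the function coded by \<open>S\<close>, with \<open>S\<close> ranging over
      all sets.\<close>
    let ?Q = "\<lambda>S p. set_decode p \<subseteq> X \<and> mono_on (set_decode p) (bounded_fun b S)"
    define R where "R S xs \<longleftrightarrow> (\<exists>p. ?Q S p \<and> eval ((F \<union> set_decode p) \<oplus> C) c [hd xs] (hd (tl xs)))" for S xs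
    have red: "reducible_on ?\<Phi> (\<lambda>S. S)" "reducible_on ?\<Phi> (\<lambda>_. X)" "reducible_on ?\<Phi> (\<lambda>_. C)"
      using reducible_on_left[of "\<lambda>S. S" "\<lambda>_. X \<oplus> C"]
        reducible_on_joinD[OF reducible_on_right[of "\<lambda>S. S" "\<lambda>_. X \<oplus> C"]] by auto
    have "decidable_on ?\<Phi> (Suc 0) (\<lambda>S xs. set_decode (hd xs) \<subseteq> X \<and>
      (\<forall>r<hd xs. \<forall>s<hd xs. r \<in> set_decode (hd xs) \<and> s \<in> set_decode (hd xs) \<and> r \<le> s
        \<longrightarrow> bounded_fun b S r \<le> bounded_fun b S s))"
      by (intro decidable_on_conj decidable_on_set_decode_subset red decidable_on_Ball_less decidable_on_imp
          decidable_on_set_decode decidable_on_le computable_on_bounded_fun[OF red(3,1) b(1)] computable_on_hd computable_on_tl)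
    then have "decidable_on ?\<Phi> (Suc 0) (\<lambda>S xs. ?Q S (hd xs))"
      by (rule decidable_on_cong) (auto simp: mono_on_def dest: mem_set_decode_less)
    from semidecidable_on_extension[OF red(3) fin this]
    have "semidecidable_on ?\<Phi> 2 R" unfolding R_def .
    with X(2) show ?thesis
    proof (cases rule: cone_avoiding_dichotomy_basis)
      case (1 n)
      \<comment> \<open>Instantiating \<open>S\<close> by the code of \<open>f\<close> gives an
        extension that is non-decreasing for \<open>f\<close> and yields a wrong output.\<close>
      from 1[of "{(x + f x) * (x + f x) + x | x. True}"]
      obtain p where p: "set_decode p \<subseteq> X" "mono_on (set_decode p) f"
        "eval ((F \<union> set_decode p) \<oplus> C) c [n] (of_bool (n \<notin> A))"
        unfolding R_def list.sel bounded_fun_code[of f b, OF b(2)] by blast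
      obtain u where u: "\<And>X. X \<subseteq> {u..} \<Longrightarrow> blocked A C c (F \<union> set_decode p) X"
        using blocked_if_wrong[OF p(3)] by blast
      obtain X' where "X' \<subseteq> X" "P (F \<union> set_decode p) X'" "X' \<subseteq> {u..}"
        using extend[OF P finite_set_decode p(1,2), of u] by blast
      then show ?thesis using u p(1) by blast
    next
      case (2 n S)
      \<comment> \<open>The counterexample \<open>S\<close> codes a function computable from
        \<open>?Z\<close>, which does not compute \<open>A\<close>. The reservoir can thus be
        thinned, computably in \<open>?Z\<close>, until every finite subset is non-decreasing for
        that function; by the choice of \<open>S\<close> none of them gives the correct
        output.\<close>
      let ?Z = "S \<oplus> (X \<oplus> C)"
      have le: "X \<le>\<^sub>T ?Z" "C \<le>\<^sub>T ?Z"
        using turing_reducible_refl[of ?Z] by (auto simp: turing_reducible_join_iff)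
      have "computable_in ?Z (bounded_fun b S)"
        unfolding computable_in_iff One_nat_def
        by (intro computable_on_bounded_fun[of "\<lambda>_. ?Z" C "\<lambda>_. S" b] reducible_on_const le b(1) computable_on_hd)
          (use turing_reducible_refl[of ?Z] in \<open>simp add: turing_reducible_join_iff\<close>)
      from reducible_mono_on_subset[OF this le(1) X(1)]
      obtain Y where Y: "Y \<subseteq> X" "infinite Y" "mono_on Y (bounded_fun b S)" "Y \<le>\<^sub>T ?Z" by blast
      have "large Y" using Y(2) not_reducible_join_mono[OF 2(2) Y(4) le(2)] unfolding large_def by blast
      \<comment> \<open>The stem is unchanged and the requirements on the reservoir pass to subsets;
        \<open>f\<close> is not asked to be non-decreasing on \<open>Y\<close>.\<close>
      then have "P F Y" using P Y(1) unfolding P_def by blast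
      moreover have "blocked A C c F Y"
      proof (rule blocked_if_never_right)
        fix E assume E: "finite E" "E \<subseteq> Y"
        then have "?Q S (set_encode E)" using Y(1,3) by (auto intro: mono_on_subset)
        then show "\<not> eval ((F \<union> E) \<oplus> C) c [n] (of_bool (n \<in> A))"
          using 2(1) E(1) set_encode_inverse[of E] unfolding R_def list.sel by metis
      qed
      ultimately show ?thesis using Y(1) by blast
    qed
  qed
  have "\<not> A \<le>\<^sub>T UNIV \<oplus> C"
    by (rule not_reducible_join_mono[OF assms(1) _ turing_reducible_refl])
      (rule turing_reducibleI, simp add: decidable_on_const)
  then have base: "P {} UNIV" unfolding P_def large_def by (simp add: mono_on_def)
  from generic_set_exists[of P, OF base ext block]
  obtain G where G: "infinite G" "\<not> A \<le>\<^sub>T G \<oplus> C"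
    "\<And>E. finite E \<Longrightarrow> E \<subseteq> G \<Longrightarrow> \<exists>F X. P F X \<and> E \<subseteq> F" by blast
  \<comment> \<open>Monotonicity concerns two points at a time, and any two points of
    \<open>G\<close> lie in a common stem.\<close>
  have "mono_on G f"
  proof (rule mono_onI)
    fix r s assume "r \<in> G" "s \<in> G" "r \<le> s"
    then obtain F X where "P F X" "{r, s} \<subseteq> F" using G(3)[of "{r, s}"] by auto
    then show "f r \<le> f s" using \<open>r \<le> s\<close> unfolding P_def by (auto dest: mono_onD)
  qed
  then show False using contra G(1,2) by blast
qed

end
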